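(* Let $p$ be a prime, $q\in\mathbb{C}_p$ with $|q-1|_p<p^{-\frac{1}{p-1}}$, $\lambda\in\mathbb{C}_p\setminus\{0\}$, and $x\in\mathbb{Z}_p$. For every integer $n\ge0$, \[ \beta_{n,q}(x)=\sum_{m=0}^n\beta_{m,q}(x|\lambda)\lambda^{n-m}S_2(n,m). \]
   Context: $q^x=\exp(x\log q)$, $[x]_q=\frac{1-q^x}{1-q}$. The $p$-adic $q$-integral of a uniformly differentiable $f$ on $\mathbb{Z}_p$ is $\int_{\mathbb{Z}_p}f(y)\,d\mu_q(y)=\lim_{N\to\infty}\frac{1}{[p^N]_q}\sum_{y=0}^{p^N-1}f(y)q^y$. The Carlitz $q$-Bernoulli polynomials are $\beta_{n,q}(x)=\int_{\mathbb{Z}_p}[x+y]_q^n\,d\mu_q(y)$. For $t\in\mathbb{C}_p$ with $|\lambda t|_p<p^{-1/(p-1)}$, $(1+\lambda t)^{a/\lambda}=\exp(\frac{a}{\lambda}\log(1+\lambda t))$, and the degenerate Carlitz $q$-Bernoulli polynomials $\beta_{n,q}(x|\lambda)$ are defined by $\int_{\mathbb{Z}_p}(1+\lambda t)^{\frac{1}{\lambda}[x+y]_q}\,d\mu_q(y)=\sum_{n\ge0}\beta_{n,q}(x|\lambda)\frac{t^n}{n!}$. $S_2(n,m)$ are the Stirling numbers of the second kind: $\frac{(e^t-1)^m}{m!}=\sum_{n\ge m}S_2(n,m)\frac{t^n}{n!}$. *)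

theory Defs
  imports
    "HOL-Analysis.Abstract_Metric_Spaces"
    "HOL-Computational_Algebra.Computational_Algebra"
    "HOL-Combinatorics.Stirling"
begin

section \<open>Limits and series for an absolute value\<close>

text \<open>
  The field of p-adic complex numbers is not a real normed space, so the norm type classes do
  not apply. An absolute value is an explicit function \<open>v\<close>, and all limits are taken in
  the metric topology of \<open>v (x - y)\<close>.
\<close>

definition val_dist :: "('a::field \<Rightarrow> real) \<Rightarrow> 'a \<Rightarrow> 'a \<Rightarrow> real" where
  "val_dist v x y = v (x - y)"

definition val_topology :: "('a::field \<Rightarrow> real) \<Rightarrow> 'a topology" where
  "val_topology v = Metric_space.mtopology UNIV (val_dist v)"

definition val_tendsto :: "('a::field \<Rightarrow> real) \<Rightarrow> (nat \<Rightarrow> 'a) \<Rightarrow> 'a \<Rightarrow> bool" where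
  "val_tendsto v X l \<longleftrightarrow> limitin (val_topology v) X l sequentially"

definition val_lim :: "('a::field \<Rightarrow> real) \<Rightarrow> (nat \<Rightarrow> 'a) \<Rightarrow> 'a" where
  "val_lim v X = (THE l. val_tendsto v X l)"

definition val_sums :: "('a::field \<Rightarrow> real) \<Rightarrow> (nat \<Rightarrow> 'a) \<Rightarrow> 'a \<Rightarrow> bool" where
  "val_sums v f s \<longleftrightarrow> val_tendsto v (\<lambda>N. \<Sum>n<N. f n) s"

definition val_suminf :: "('a::field \<Rightarrow> real) \<Rightarrow> (nat \<Rightarrow> 'a) \<Rightarrow> 'a" where
  "val_suminf v f = (THE s. val_sums v f s)"


section \<open>The field of p-adic complex numbers\<close>

text \<open>
  In a complete field containing the rationals with their p-adic absolute value, the closure of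
  the rationals is (a copy of) the field of p-adic numbers.
\<close>

definition padic_Qp :: "('a::field_char_0 \<Rightarrow> real) \<Rightarrow> 'a set" where
  "padic_Qp v = val_topology v closure_of \<rat>"

definition padic_Zp :: "('a::field_char_0 \<Rightarrow> real) \<Rightarrow> 'a set" where
  "padic_Zp v = {x \<in> padic_Qp v. v x \<le> 1}"

definition padic_algebraic :: "('a::field_char_0 \<Rightarrow> real) \<Rightarrow> 'a set" where
  "padic_algebraic v =
     {z. \<exists>P :: 'a poly. P \<noteq> 0 \<and> (\<forall>i. coeff P i \<in> padic_Qp v) \<and> poly P z = 0}"

text \<open>
  \<open>padic_complex p v\<close> says that the ambient field with absolute value \<open>v\<close> is the completion of
  an algebraic closure of the field of p-adic numbers. This determines the pair up to isometric
  isomorphism. Multiplicativity and the ultrametric inequality, with \<open>v p = 1 / p\<close>, force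
  \<open>v\<close> to be the p-adic absolute value on the rationals.
\<close>

locale padic_complex =
  fixes p :: nat and v :: "'a::field_char_0 \<Rightarrow> real"
  assumes prime_p: "prime p"
    and v_nonneg: "0 \<le> v x"
    and v_eq_0_iff: "v x = 0 \<longleftrightarrow> x = 0"
    and v_mult: "v (x * y) = v x * v y"
    and v_ultrametric: "v (x + y) \<le> max (v x) (v y)"
    and v_p: "v (of_nat p) = 1 / real p"
    and complete: "Metric_space.mcomplete UNIV (val_dist v)"
    and algebraic_closed:
      "\<And>P :: 'a poly. degree P > 0 \<Longrightarrow> (\<forall>i. coeff P i \<in> padic_algebraic v) \<Longrightarrow>
         \<exists>z \<in> padic_algebraic v. poly P z = 0"
    and algebraic_dense: "val_topology v closure_of padic_algebraic v = UNIV"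
begin

lemma v_1: "v 1 = 1"
  using v_mult[of 1 1] v_eq_0_iff[of 1] by simp

lemma v_minus: "v (- x) = v x"
proof -
  have "v (-1) * v (-1) = 1"
    using v_mult[of "-1" "-1"] v_1 by simp
  then have "v (-1) = 1"
    using v_nonneg[of "-1"] by (metis abs_of_nonneg abs_mult_self_eq real_sqrt_abs2 real_sqrt_one)
  then show ?thesis
    using v_mult[of "-1" x] by simp
qed

lemma Metric_space_val_dist: "Metric_space UNIV (val_dist v)"
proof
  fix x y z
  show "0 \<le> val_dist v x y"
    by (simp add: val_dist_def v_nonneg)
  show "val_dist v x y = val_dist v y x"
    using v_minus[of "x - y"] by (simp add: val_dist_def)
  show "val_dist v x y = 0 \<longleftrightarrow> x = y"
    by (simp add: val_dist_def v_eq_0_iff)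
  have "v (x - z) \<le> max (v (x - y)) (v (y - z))"
    using v_ultrametric[of "x - y" "y - z"] by simp
  also have "\<dots> \<le> v (x - y) + v (y - z)"
    using v_nonneg[of "x - y"] v_nonneg[of "y - z"] by simp
  finally show "val_dist v x z \<le> val_dist v x y + val_dist v y z"
    by (simp add: val_dist_def)
qed

end

definition padic_radius :: "nat \<Rightarrow> real" where
  "padic_radius p = real p powr (- 1 / (real p - 1))"

definition padic_exp :: "('a::field_char_0 \<Rightarrow> real) \<Rightarrow> 'a \<Rightarrow> 'a" where
  "padic_exp v x = val_suminf v (\<lambda>n. x ^ n / fact n)"

definition padic_log :: "('a::field_char_0 \<Rightarrow> real) \<Rightarrow> 'a \<Rightarrow> 'a" where
  "padic_log v x = val_suminf v (\<lambda>n. (-1) ^ n * (x - 1) ^ Suc n / of_nat (Suc n))"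


section \<open>The p-adic q-integral and Carlitz q-Bernoulli polynomials\<close>

definition q_power :: "('a::field_char_0 \<Rightarrow> real) \<Rightarrow> 'a \<Rightarrow> 'a \<Rightarrow> 'a" where
  "q_power v q x = padic_exp v (x * padic_log v q)"

text \<open>
  For \<open>q = 1\<close> the quotient is read as its limit \<open>x\<close>; division by zero in HOL would make it \<open>0\<close>.
\<close>

definition q_number :: "('a::field_char_0 \<Rightarrow> real) \<Rightarrow> 'a \<Rightarrow> 'a \<Rightarrow> 'a" where
  "q_number v q x = (if q = 1 then x else (1 - q_power v q x) / (1 - q))"

definition q_integral :: "nat \<Rightarrow> ('a::field_char_0 \<Rightarrow> real) \<Rightarrow> 'a \<Rightarrow> ('a \<Rightarrow> 'a) \<Rightarrow> 'a" where
  "q_integral p v q f =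
     val_lim v (\<lambda>N. 1 / q_number v q (of_nat (p ^ N)) *
                   (\<Sum>y<p ^ N. f (of_nat y) * q_power v q (of_nat y)))"

definition carlitz_beta :: "nat \<Rightarrow> ('a::field_char_0 \<Rightarrow> real) \<Rightarrow> 'a \<Rightarrow> nat \<Rightarrow> 'a \<Rightarrow> 'a" where
  "carlitz_beta p v q n x = q_integral p v q (\<lambda>y. q_number v q (x + y) ^ n)"

text \<open>\<open>degenerate_exp v lam a t\<close> is \<open>(1 + lam * t)\<close> raised to the power \<open>a / lam\<close>.\<close>

definition degenerate_exp :: "('a::field_char_0 \<Rightarrow> real) \<Rightarrow> 'a \<Rightarrow> 'a \<Rightarrow> 'a \<Rightarrow> 'a" where
  "degenerate_exp v lam a t = padic_exp v (a / lam * padic_log v (1 + lam * t))"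

text \<open>
  The degenerate polynomials are the coefficients of the exponential generating function given by
  the integral. The bound on \<open>lam * t\<close> makes the logarithm converge; as \<open>v\<close> of the logarithm then
  is \<open>v (lam * t)\<close>, the bound on \<open>t\<close> is what makes the exponential converge (it follows from the
  first bound only if \<open>v lam \<ge> 1\<close>).
\<close>

definition degenerate_carlitz_egf ::
  "nat \<Rightarrow> ('a::field_char_0 \<Rightarrow> real) \<Rightarrow> 'a \<Rightarrow> 'a \<Rightarrow> 'a \<Rightarrow> (nat \<Rightarrow> 'a) \<Rightarrow> bool" where
  "degenerate_carlitz_egf p v q lam x b \<longleftrightarrow>
     (\<forall>t. v (lam * t) < padic_radius p \<and> v t < padic_radius p \<longrightarrow>
        val_sums v (\<lambda>n. b n * t ^ n / fact n)
          (q_integral p v q (\<lambda>y. degenerate_exp v lam (q_number v q (x + y)) t)))"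

definition degenerate_carlitz_beta ::
  "nat \<Rightarrow> ('a::field_char_0 \<Rightarrow> real) \<Rightarrow> 'a \<Rightarrow> 'a \<Rightarrow> nat \<Rightarrow> 'a \<Rightarrow> 'a" where
  "degenerate_carlitz_beta p v q lam n x = (THE b. degenerate_carlitz_egf p v q lam x b) n"


section \<open>Stirling numbers of the second kind\<close>

text \<open>
  The library defines \<^const>\<open>Stirling\<close> by recursion; it has the usual generating function.
\<close>

lemma Stirling_egf:
  "(fps_exp 1 - 1) ^ m / fps_const (fact m) =
     Abs_fps (\<lambda>n. of_nat (Stirling n m) / fact n :: 'a::field_char_0)"
proof -
  define S where "S m = Abs_fps (\<lambda>n. of_nat (Stirling n m) / fact n :: 'a)" for m
  define E where "E = (fps_exp 1 - 1 :: 'a fps)"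
  have dE: "fps_deriv E = E + 1"
    by (simp add: E_def)
  have dS: "fps_deriv (S (Suc m)) = of_nat (Suc m) * S (Suc m) + S m" for m
  proof (rule fps_ext)
    fix n
    have "fps_nth (fps_deriv (S (Suc m))) n =
        of_nat (Suc m * Stirling n (Suc m) + Stirling n m) / fact n"
      by (simp add: S_def field_simps del: of_nat_Suc of_nat_add of_nat_mult mult_Suc)
    then show "fps_nth (fps_deriv (S (Suc m))) n =
        fps_nth (of_nat (Suc m) * S (Suc m) + S m) n"
      by (simp add: S_def fps_of_nat [symmetric] add_divide_distrib del: of_nat_Suc mult_Suc)
  qed
  have "E ^ m = of_nat (fact m) * S m" for m
  proof (induction m)
    case 0
    have "S 0 = 1"
    proof (rule fps_ext)
      fix n
      show "fps_nth (S 0) n = fps_nth 1 n"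
        by (cases n) (simp_all add: S_def)
    qed
    then show ?case by simp
  next
    case (Suc m)
    define D where "D = E ^ Suc m - of_nat (fact (Suc m)) * S (Suc m)"
    have "fps_deriv (E ^ Suc m) = of_nat (Suc m) * E ^ Suc m + of_nat (Suc m) * E ^ m"
      unfolding fps_deriv_power' by (simp add: dE fps_of_nat algebra_simps del: of_nat_Suc)
    moreover have "fps_deriv (of_nat (fact (Suc m)) * S (Suc m)) =
        of_nat (Suc m) * (of_nat (fact (Suc m)) * S (Suc m)) + of_nat (Suc m) * E ^ m"
      unfolding fps_deriv_mult fps_deriv_of_nat dS Suc.IH fact_Suc of_nat_mult of_nat_id
      by (simp only: algebra_simps mult_zero_left add_0_left add_0_right)
    ultimately have dD: "fps_deriv D = of_nat (Suc m) * D"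
      unfolding D_def fps_deriv_sub by (simp only: algebra_simps)
    have "fps_nth D n = 0" for n
    proof (induction n)
      case 0
      then show ?case by (simp add: D_def E_def S_def fps_of_nat [symmetric])
    next
      case (Suc n)
      have "of_nat (Suc n) * fps_nth D (Suc n) = fps_nth (of_nat (Suc m) * D) n"
        using dD by (metis fps_deriv_nth Suc_eq_plus1)
      also have "\<dots> = of_nat (Suc m) * fps_nth D n"
        by (metis fps_mult_left_const_nth fps_of_nat)
      finally show ?case
        using Suc.IH by (simp del: of_nat_Suc)
    qed
    then have "D = 0" by (simp add: fps_eq_iff)
    then show ?case by (simp add: D_def)
  qed
  then have "(fps_exp 1 - 1) ^ m = of_nat (fact m) * S m"
    by (simp add: E_def)
  moreover have "(of_nat (fact m) :: 'a fps) = fps_const (fact m)"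
    by (metis fps_of_nat of_nat_fact)
  ultimately show ?thesis
    by (simp add: S_def)
qed

end

theory Submission
  imports Defs
begin

text \<open>
  The degenerate exponential expands as
  \<open>(1 + lam t)^(a / lam) = (\<Sum>n. t^n / n! (\<Sum>m\<le>n. s(n, m) lam^(n - m) a^m))\<close> with signed Stirling
  numbers of the first kind \<open>s(n, m)\<close>. Put \<open>a = [x + y]\<close> and integrate over \<open>y\<close> term by term: the
  coefficients of the generating function are \<open>(\<Sum>m\<le>n. s(n, m) lam^(n - m) \<beta>\<^sub>m)\<close>, and Stirling
  inversion gives the theorem. Exchanging the integral with the sum needs the Riemann sums of
  \<open>[x + y]^m\<close> to be bounded uniformly in \<open>m\<close> and the level \<open>N\<close>. Comparing levels \<open>N\<close> and \<open>N + 1\<close> by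
  expanding \<open>[x + y + p^N k] = [x + y] + q^(x + y) [p^N k]\<close> bounds them by \<open>p\<close>; the same comparison,
  repeated with this bound, shows that they converge.
\<close>

section \<open>Series in an ultrametric field\<close>

context padic_complex
begin

section \<open>Elementary properties of an ultrametric absolute value\<close>

lemma v_0 [simp]: "v 0 = 0"
  using v_eq_0_iff by simp

lemma v_pos: "x \<noteq> 0 \<Longrightarrow> 0 < v x"
  using v_nonneg[of x] v_eq_0_iff[of x] by linarith

lemma v_power: "v (x ^ n) = v x ^ n"
  by (induction n) (simp_all add: v_1 v_mult)

lemma v_divide: "v (x / y) = v x / v y"
proof (cases "y = 0")
  case False
  then have "v (x / y) * v y = v x"
    using v_mult[of "x / y" y] by simp
  then show ?thesis
    using v_pos[OF False] by (simp add: field_simps)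
qed simp

lemma v_diff: "v (x - y) \<le> max (v x) (v y)"
  using v_ultrametric[of x "- y"] by (simp add: v_minus)

lemma v_minus_commute: "v (x - y) = v (y - x)"
  using v_minus[of "x - y"] by simp

lemma v_triangle: "v (x + y) \<le> v x + v y"
  using v_ultrametric[of x y] v_nonneg[of x] v_nonneg[of y] by linarith

text \<open>Since \<open>y = (x + y) - x\<close>, the value \<open>v y\<close> is at most the larger
  of \<open>v (x + y)\<close> and \<open>v x\<close>, and the latter is too small to attain
  it.\<close>

lemma v_add_eq:
  assumes "v x < v y"
  shows "v (x + y) = v y"
  using v_ultrametric[of x y] v_diff[of "x + y" x] assms by auto

lemma v_sum_le:
  assumes "\<And>i. i \<in> S \<Longrightarrow> v (f i) \<le> C" and "0 \<le> C"
  shows "v (sum f S) \<le> C"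
  using assms
proof (induction S rule: infinite_finite_induct)
  case (insert x F)
  then show ?case
    using v_ultrametric[of "f x" "sum f F"] by force
qed simp_all

lemma v_power_le_1: "v x \<le> 1 \<Longrightarrow> v (x ^ n) \<le> 1"
  by (simp add: v_power v_nonneg power_le_one)

lemma v_mult_le_1: "v x \<le> 1 \<Longrightarrow> v y \<le> 1 \<Longrightarrow> v (x * y) \<le> 1"
  by (simp add: v_mult v_nonneg mult_le_one)

lemma v_mult_le: "v x \<le> 1 \<Longrightarrow> v (x * y) \<le> v y"
  by (simp add: v_mult v_nonneg mult_left_le_one_le)

section \<open>Absolute values of integers and factorials, and the radius of convergence\<close>

lemma v_of_nat_le_1: "v (of_nat n) \<le> 1"
proof (induction n)
  case (Suc n)
  then show ?case
    using v_ultrametric[of 1 "of_nat n"] by (simp add: v_1)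
qed simp

lemma p_gt_1: "1 < p"
  using prime_p prime_gt_1_nat by blast

text \<open>Bezout gives \<open>a * n = b * p + 1\<close>, whose absolute value is 1 because 1
  dominates \<open>b * p\<close>. Neither factor on the left exceeds 1, so both equal 1.\<close>

lemma v_of_nat_coprime:
  assumes "\<not> p dvd n"
  shows "v (of_nat n) = 1"
proof -
  have "coprime n p"
    using assms prime_p by (metis coprime_commute prime_imp_coprime)
  then obtain a b where ab: "a * n = b * p + 1"
    using coprime_bezout_strong[of n p] p_gt_1 by (metis less_irrefl mult.commute)
  have "v (of_nat (b * p)) < v 1"
    using v_of_nat_le_1[of b] p_gt_1 v_nonneg[of "of_nat b"]
    by (simp add: v_mult v_p v_1 divide_less_eq)
  then have "v (of_nat (b * p) + 1) = 1"
    using v_add_eq v_1 by metis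
  then have "v (of_nat a) * v (of_nat n) = 1"
    using ab by (metis of_nat_1 of_nat_add of_nat_mult v_mult)
  moreover have "v (of_nat a) * v (of_nat n) \<le> v (of_nat n)"
    using v_of_nat_le_1[of a] v_nonneg by (simp add: mult_left_le_one_le)
  ultimately show ?thesis
    using v_of_nat_le_1[of n] by linarith
qed

text \<open>Legendre's formula in recursive form: only the multiples of \<open>p\<close> up to
  \<open>n\<close> contribute, and taking one factor \<open>p\<close> out of each leaves the factors
  of \<open>fact (n div p)\<close>.\<close>

lemma v_fact_div: "v (fact n) = (1 / real p) ^ (n div p) * v (fact (n div p))"
proof (induction n)
  case (Suc n)
  have "v (fact (Suc n)) = v (of_nat (Suc n)) * v (fact n)"
    by (simp add: v_mult del: of_nat_Suc)
  moreover have "v (of_nat (Suc n)) * v (fact n) =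
      (1 / real p) ^ (Suc n div p) * v (fact (Suc n div p))"
  proof (cases "p dvd Suc n")
    case False
    then have "Suc n div p = n div p"
      by (metis div_Suc dvd_eq_mod_eq_0)
    then show ?thesis
      using v_of_nat_coprime[OF False] Suc.IH by simp
  next
    case True
    then have e: "Suc n div p = Suc (n div p)"
      by (metis div_Suc dvd_eq_mod_eq_0)
    then have "Suc n = p * Suc (n div p)"
      using True by (metis dvd_mult_div_cancel)
    then have "v (of_nat (Suc n)) = 1 / real p * v (of_nat (Suc (n div p)))"
      by (metis of_nat_mult v_mult v_p)
    then show ?thesis
      unfolding e Suc.IH by (simp add: v_mult mult_ac del: of_nat_Suc)
  qed
  ultimately show ?case by simp
qed (simp add: v_1)

abbreviation "r \<equiv> padic_radius p"

lemma padic_radius_pos: "0 < r"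
  and padic_radius_less_1: "r < 1"
  and padic_radius_power: "r ^ (p - 1) = 1 / real p"
proof -
  show "0 < r" "r < 1"
    using p_gt_1 unfolding padic_radius_def by (auto simp: powr_less_one)
  have "r ^ (p - 1) = r powr (real p - 1)"
    using p_gt_1 \<open>0 < r\<close> by (simp add: powr_realpow [symmetric] of_nat_diff)
  also have "\<dots> = real p powr (- 1)"
    using p_gt_1 unfolding padic_radius_def powr_powr by simp
  also have "\<dots> = 1 / real p"
    using p_gt_1 by (simp add: powr_minus_divide)
  finally show "r ^ (p - 1) = 1 / real p" .
qed

text \<open>The exponent of \<open>p\<close> in \<open>n!\<close> is at most
  \<open>(n - 1) / (p - 1)\<close>, and \<open>r ^ (p - 1) = 1 / p\<close>. The induction passes
  from \<open>n\<close> to \<open>n div p\<close>.\<close>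

lemma v_fact_ge: "n > 0 \<Longrightarrow> r ^ (n - 1) \<le> v (fact n)"
proof (induction n rule: less_induct)
  case (less n)
  define k where "k = n div p"
  show ?case
  proof (cases "k = 0")
    case True
    then have "v (fact n) = 1"
      using v_fact_div[of n] by (simp add: k_def [symmetric] v_1)
    then show ?thesis
      using padic_radius_pos padic_radius_less_1 by (simp add: power_le_one)
  next
    case False
    have "k < n"
      using False p_gt_1 less.prems by (simp add: k_def)
    have le: "p * k \<le> n"
      by (simp add: k_def)
    \<comment> \<open>The factor \<open>(1 / p) ^ k\<close> costs exponent
      \<open>(p - 1) * k\<close> of \<open>r\<close>, and the induction hypothesis costs
      \<open>k - 1\<close>.\<close>
    have "(p - 1) * k + (k - 1) = p * k - 1"
      using False p_gt_1 by (cases k; cases p) auto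
    moreover have "p * k - 1 \<le> n - 1"
      using le by linarith
    ultimately have "r ^ (n - 1) \<le> r ^ ((p - 1) * k + (k - 1))"
      using padic_radius_pos padic_radius_less_1 by (simp add: power_decreasing)
    also have "\<dots> = (1 / real p) ^ k * r ^ (k - 1)"
      unfolding power_add power_mult padic_radius_power by simp
    also have "\<dots> \<le> (1 / real p) ^ k * v (fact k)"
      using less.IH[OF \<open>k < n\<close>] False p_gt_1 by (intro mult_left_mono) auto
    also have "\<dots> = v (fact n)"
      using v_fact_div[of n] by (simp add: k_def)
    finally show ?thesis .
  qed
qed

lemma v_fact_pos: "0 < v (fact n)"
  by (simp add: v_pos)

text \<open>One factor \<open>R\<close> is split off and the other \<open>n - 1\<close> are absorbed
  by the factorial. Beyond convergence, this yields the sharp estimates for log(1 + u) and exp(x) -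
  1.\<close>

lemma power_div_v_fact_le:
  assumes "0 \<le> R" and "R < r" and "n > 0"
  shows "R ^ n / v (fact n) \<le> R"
proof -
  have "R ^ n = R * R ^ (n - 1)"
    using assms by (simp add: power_eq_if)
  also have "\<dots> \<le> R * v (fact n)"
  proof (rule mult_left_mono[OF _ assms(1)])
    have "R ^ (n - 1) \<le> r ^ (n - 1)"
      using assms by (intro power_mono) auto
    then show "R ^ (n - 1) \<le> v (fact n)"
      using v_fact_ge[OF assms(3)] by linarith
  qed
  finally show ?thesis
    using v_fact_pos[of n] by (simp add: field_simps)
qed

text \<open>Domination by the geometric sequence \<open>(R / r) ^ n\<close>; this sequence also
  serves as the majorant in the later interchanges of summation.\<close>

lemma power_div_v_fact_tendsto_0:
  assumes "0 \<le> R" and "R < r"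
  shows "(\<lambda>n. R ^ n / v (fact n)) \<longlonglongrightarrow> 0"
proof (rule real_tendsto_sandwich[OF _ _ tendsto_const])
  show "(\<lambda>n. (R / r) ^ n) \<longlonglongrightarrow> 0"
    using assms padic_radius_pos by (intro LIMSEQ_realpow_zero) auto
  show "\<forall>\<^sub>F n in sequentially. 0 \<le> R ^ n / v (fact n)"
    using assms v_nonneg by simp
  have "R ^ n / v (fact n) \<le> (R / r) ^ n" for n
  proof -
    have "r ^ n \<le> v (fact n)"
    proof (cases "n = 0")
      case False
      have "r ^ n \<le> r ^ (n - 1)"
        using padic_radius_pos padic_radius_less_1 by (intro power_decreasing) auto
      then show ?thesis
        using v_fact_ge[of n] False by auto
    qed (simp add: v_1)
    then have "R ^ n / v (fact n) \<le> R ^ n / r ^ n"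
      using assms padic_radius_pos by (intro divide_left_mono) (auto intro!: mult_pos_pos v_fact_pos)
    then show ?thesis
      by (simp add: power_divide)
  qed
  then show "\<forall>\<^sub>F n in sequentially. R ^ n / v (fact n) \<le> (R / r) ^ n"
    by simp
qed

section \<open>Limits with respect to \<open>v\<close>, reduced to real null sequences\<close>

lemma val_tendsto_iff: "val_tendsto v X l \<longleftrightarrow> (\<lambda>n. v (X n - l)) \<longlonglongrightarrow> 0"
proof -
  interpret Metric_space UNIV "val_dist v"
    by (rule Metric_space_val_dist)
  show ?thesis
    unfolding val_tendsto_def val_topology_def limitin_metric tendsto_iff
    by (simp add: val_dist_def v_nonneg dist_real_def)
qed

lemma val_tendsto_unique:
  assumes "val_tendsto v X a" and "val_tendsto v X b"
  shows "a = b"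
proof -
  have "(\<lambda>n. v (X n - a) + v (X n - b)) \<longlonglongrightarrow> 0"
    using tendsto_add[OF assms[unfolded val_tendsto_iff]] by simp
  moreover have "v (a - b) \<le> v (X n - a) + v (X n - b)" for n
    using v_triangle[of "a - X n" "X n - b"] v_minus_commute[of a "X n"] by simp
  ultimately have "v (a - b) \<le> 0"
    by (intro LIMSEQ_le_const) auto
  then show ?thesis
    using v_nonneg[of "a - b"] v_eq_0_iff[of "a - b"] by simp
qed

lemma val_lim_eq: "val_tendsto v X l \<Longrightarrow> val_lim v X = l"
  unfolding val_lim_def using val_tendsto_unique by blast

lemma val_suminf_eq: "val_sums v f s \<Longrightarrow> val_suminf v f = s"
  unfolding val_suminf_def val_sums_def using val_tendsto_unique by blast

lemma val_tendsto_sandwich: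
  assumes "\<And>n. v (X n - l) \<le> \<epsilon> n" and "\<epsilon> \<longlonglongrightarrow> 0"
  shows "val_tendsto v X l"
  unfolding val_tendsto_iff
  by (rule real_tendsto_sandwich[OF _ _ tendsto_const assms(2)]) (auto simp: v_nonneg assms(1))

lemma val_tendsto_const: "val_tendsto v (\<lambda>n. c) c"
  by (simp add: val_tendsto_iff)

lemma val_tendsto_add:
  assumes "val_tendsto v X a" and "val_tendsto v Y b"
  shows "val_tendsto v (\<lambda>n. X n + Y n) (a + b)"
proof (rule val_tendsto_sandwich)
  show "v (X n + Y n - (a + b)) \<le> v (X n - a) + v (Y n - b)" for n
    using v_triangle[of "X n - a" "Y n - b"] by (simp add: algebra_simps)
  show "(\<lambda>n. v (X n - a) + v (Y n - b)) \<longlonglongrightarrow> 0"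
    using tendsto_add[OF assms[unfolded val_tendsto_iff]] by simp
qed

lemma val_tendsto_mult_left:
  assumes "val_tendsto v X a"
  shows "val_tendsto v (\<lambda>n. c * X n) (c * a)"
  using tendsto_mult_left[OF assms[unfolded val_tendsto_iff], of "v c"]
  by (simp add: val_tendsto_iff v_mult [symmetric] right_diff_distrib)

lemma val_tendsto_sum:
  assumes "\<And>i. i \<in> S \<Longrightarrow> val_tendsto v (X i) (a i)"
  shows "val_tendsto v (\<lambda>n. \<Sum>i\<in>S. X i n) (\<Sum>i\<in>S. a i)"
  using assms
  by (induction S rule: infinite_finite_induct) (auto simp: val_tendsto_const val_tendsto_add)

lemma val_tendsto_bound:
  assumes "val_tendsto v X a" and "\<forall>\<^sub>F n in sequentially. v (X n) \<le> C"
  shows "v a \<le> C"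
proof -
  have "(\<lambda>n. v (X n - a) + C) \<longlonglongrightarrow> C"
    using tendsto_add[OF assms(1)[unfolded val_tendsto_iff] tendsto_const[of C]] by simp
  moreover have "\<forall>\<^sub>F n in sequentially. v a \<le> v (X n - a) + C"
    using assms(2)
  proof eventually_elim
    case (elim n)
    then show ?case
      using v_triangle[of "a - X n" "X n"] v_minus_commute[of a "X n"] by simp
  qed
  ultimately show ?thesis
    by (rule tendsto_lowerbound) simp
qed

text \<open>By the ultrametric inequality \<open>X n - X N\<close> is no larger than the largest
  single step after \<open>N\<close>, so vanishing steps already give a Cauchy sequence.\<close>

lemma val_convergent:
  assumes "(\<lambda>n. v (X (Suc n) - X n)) \<longlonglongrightarrow> 0"
  shows "\<exists>l. val_tendsto v X l"
proof -
  interpret Metric_space UNIV "val_dist v"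
    by (rule Metric_space_val_dist)
  have "MCauchy X"
    unfolding MCauchy_def
  proof (intro conjI allI impI)
    fix \<epsilon> :: real
    assume "0 < \<epsilon>"
    then obtain N where N: "\<And>n. n \<ge> N \<Longrightarrow> v (X (Suc n) - X n) < \<epsilon>"
      using order_tendstoD(2)[OF assms] unfolding eventually_sequentially by blast
    have *: "v (X n - X N) < \<epsilon>" if "N \<le> n" for n
      using that
    proof (induction n rule: dec_induct)
      case base
      then show ?case using \<open>0 < \<epsilon>\<close> by simp
    next
      case (step n)
      then show ?case
        using v_ultrametric[of "X (Suc n) - X n" "X n - X N"] N[of n] by simp
    qed
    have "val_dist v (X n) (X m) < \<epsilon>" if "N \<le> n" "N \<le> m" for n m
      using v_diff[of "X n - X N" "X m - X N"] *[OF that(1)] *[OF that(2)]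
      by (simp add: val_dist_def)
    then show "\<exists>N. \<forall>n n'. N \<le> n \<longrightarrow> N \<le> n' \<longrightarrow> val_dist v (X n) (X n') < \<epsilon>"
      by blast
  qed simp
  then show ?thesis
    using complete unfolding mcomplete_def val_tendsto_def val_topology_def by blast
qed

section \<open>Infinite series\<close>

lemma val_summable:
  assumes "(\<lambda>n. v (f n)) \<longlonglongrightarrow> 0"
  shows "\<exists>s. val_sums v f s"
  unfolding val_sums_def by (rule val_convergent) (simp add: assms)

lemma val_sums_add: "val_sums v f a \<Longrightarrow> val_sums v g b \<Longrightarrow> val_sums v (\<lambda>n. f n + g n) (a + b)"
  unfolding val_sums_def sum.distrib by (rule val_tendsto_add)

lemma val_sums_mult_left: "val_sums v f a \<Longrightarrow> val_sums v (\<lambda>n. c * f n) (c * a)"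
  unfolding val_sums_def sum_distrib_left [symmetric] by (rule val_tendsto_mult_left)

lemma val_sums_sum:
  assumes "\<And>i. i \<in> S \<Longrightarrow> val_sums v (f i) (a i)"
  shows "val_sums v (\<lambda>n. \<Sum>i\<in>S. f i n) (\<Sum>i\<in>S. a i)"
  using val_tendsto_sum[of S "\<lambda>i N. \<Sum>n<N. f i n" a] assms
  unfolding val_sums_def by (simp add: sum.swap[of _ S])

lemma val_sums_finite:
  assumes "\<And>n. n \<ge> N \<Longrightarrow> f n = 0"
  shows "val_sums v f (\<Sum>n<N. f n)"
proof -
  have "v ((\<Sum>n<M. f n) - (\<Sum>n<N. f n)) = 0" if "M \<ge> N" for M
  proof -
    have "(\<Sum>n<M. f n) = (\<Sum>n<N. f n)"
      using that assms by (intro sum.mono_neutral_right) auto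
    then show ?thesis
      by simp
  qed
  then have "\<forall>\<^sub>F M in sequentially. v ((\<Sum>n<M. f n) - (\<Sum>n<N. f n)) = 0"
    unfolding eventually_sequentially by blast
  then show ?thesis
    unfolding val_sums_def val_tendsto_iff by (rule tendsto_eventually)
qed

text \<open>Prepends a term; needed because \<open>padic_log\<close> starts with exponent 1 at index
  0.\<close>

lemma val_sums_Suc:
  assumes "val_sums v (\<lambda>n. f (Suc n)) s"
  shows "val_sums v f (f 0 + s)"
proof -
  have "val_tendsto v (\<lambda>N. f 0 + (\<Sum>n<N. f (Suc n))) (f 0 + s)"
    using val_tendsto_add[OF val_tendsto_const] assms unfolding val_sums_def by blast
  then have "(\<lambda>N. v ((\<Sum>n<Suc N. f n) - (f 0 + s))) \<longlonglongrightarrow> 0"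
    unfolding val_tendsto_iff sum.lessThan_Suc_shift .
  then show ?thesis
    unfolding val_sums_def val_tendsto_iff
    using LIMSEQ_imp_Suc[of "\<lambda>N. v ((\<Sum>n<N. f n) - (f 0 + s))"] by blast
qed

text \<open>A finite block of terms is bounded by its largest term, and the bound survives the
  limit. With \<open>M\<close> equal to 0 or 1 this estimates log(1 + u) and exp(x) - 1.\<close>

lemma val_sums_tail_le:
  assumes "val_sums v f s" and "\<And>n. n \<ge> M \<Longrightarrow> v (f n) \<le> C" and "0 \<le> C"
  shows "v (s - (\<Sum>n<M. f n)) \<le> C"
proof (rule val_tendsto_bound)
  show "val_tendsto v (\<lambda>N. (\<Sum>n<N. f n) + - (\<Sum>n<M. f n)) (s - (\<Sum>n<M. f n))"
    using val_tendsto_add[OF assms(1)[unfolded val_sums_def]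
        val_tendsto_const[of "- (\<Sum>n<M. f n)"]] by simp
  have "v ((\<Sum>n<N. f n) + - (\<Sum>n<M. f n)) \<le> C" if "M \<le> N" for N
  proof -
    have "(\<Sum>n<N. f n) = (\<Sum>n<M. f n) + (\<Sum>n=M..<N. f n)"
      using sum.atLeastLessThan_concat[of 0 M N f] that by (simp add: lessThan_atLeast0)
    then show ?thesis
      using v_sum_le[of "{M..<N}" f C] assms by simp
  qed
  then show "\<forall>\<^sub>F N in sequentially. v ((\<Sum>n<N. f n) + - (\<Sum>n<M. f n)) \<le> C"
    by (auto simp: eventually_sequentially)
qed

lemma val_sums_terms_tendsto_0:
  assumes "val_sums v f s"
  shows "(\<lambda>n. v (f n)) \<longlonglongrightarrow> 0"
proof -
  have l: "(\<lambda>N. v ((\<Sum>n<N. f n) - s)) \<longlonglongrightarrow> 0"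
    using assms unfolding val_sums_def val_tendsto_iff .
  have "(\<lambda>N. v ((\<Sum>n<Suc N. f n) - s) + v ((\<Sum>n<N. f n) - s)) \<longlonglongrightarrow> 0"
    using tendsto_add[OF LIMSEQ_Suc[OF l] l] by simp
  then have "val_tendsto v f 0"
    by (rule val_tendsto_sandwich[rotated])
      (use v_triangle[of "(\<Sum>n<Suc N. f n) - s" "s - (\<Sum>n<N. f n)" for N]
        v_minus_commute[of s "\<Sum>n<N. f n" for N] in simp)
  then show ?thesis
    by (simp add: val_tendsto_iff)
qed

section \<open>Cauchy products and interchange of limits\<close>

lemma tendsto_0_bounded:
  assumes "(\<lambda>n. v (f n)) \<longlonglongrightarrow> 0"
  obtains M where "0 < M" and "\<And>n. v (f n) \<le> M"
proof -
  have "Bseq (\<lambda>n. v (f n))"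
    using assms convergent_imp_Bseq convergentI by blast
  then show thesis
    using that unfolding Bseq_def by (auto simp: v_nonneg)
qed

text \<open>The product of the partial sums exceeds the partial sum of the Cauchy product by the
  terms with \<open>i, j < N \<le> i + j\<close>. In each of them one index is large, and the
  ultrametric inequality bounds their sum by a single term, so absolute convergence is not an
  issue.\<close>

lemma val_sums_Cauchy_product:
  assumes f: "val_sums v f a" and g: "val_sums v g b"
  shows "val_sums v (\<lambda>n. \<Sum>i\<le>n. f i * g (n - i)) (a * b)"
proof -
  have f0: "(\<lambda>n. v (f n)) \<longlonglongrightarrow> 0" and g0: "(\<lambda>n. v (g n)) \<longlonglongrightarrow> 0"
    using f g val_sums_terms_tendsto_0 by blast+
  obtain A B where A: "0 < A" "\<And>n. v (f n) \<le> A" and B: "0 < B" "\<And>n. v (g n) \<le> B"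
    using tendsto_0_bounded[OF f0] tendsto_0_bounded[OF g0] by metis
  define F G where "F N = (\<Sum>n<N. f n)" and "G N = (\<Sum>n<N. g n)" for N
  define H where "H N = (\<Sum>n<N. \<Sum>i\<le>n. f i * g (n - i))" for N
  have FG: "F N * G N - H N = (\<Sum>(i,j)\<in>{(i,j). i < N \<and> j < N \<and> N \<le> i + j}. f i * g j)" for N
  proof -
    have "F N * G N = (\<Sum>(i,j)\<in>{..<N} \<times> {..<N}. f i * g j)"
      unfolding F_def G_def by (simp add: sum_product sum.cartesian_product)
    moreover have "H N = (\<Sum>(i,j)\<in>{(i,j). i + j < N}. f i * g j)"
      unfolding H_def by (simp add: sum.triangle_reindex)
    moreover have "{..<N} \<times> {..<N} =
        {(i,j). i + j < N} \<union> {(i,j). i < N \<and> j < N \<and> N \<le> i + j}"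
      by auto
    moreover have "finite {(i,j). i + j < N}" "finite {(i,j). i < N \<and> j < N \<and> N \<le> i + j}"
      by (rule finite_subset[of _ "{..<N} \<times> {..<N}"]; auto)+
    ultimately show ?thesis
      by (simp add: sum.union_disjoint disjoint_iff)
  qed
  have FGlim: "val_tendsto v (\<lambda>N. F N * G N) (a * b)"
  proof (rule val_tendsto_sandwich)
    have "v (F N * G N - a * b) \<le> v (F N - a) * B + v a * v (G N - b)" for N
    proof -
      have "F N * G N - a * b = (F N - a) * G N + a * (G N - b)"
        by (simp add: algebra_simps)
      moreover have "v (G N) \<le> B"
        unfolding G_def using B by (intro v_sum_le) auto
      ultimately show ?thesis
        using v_triangle[of "(F N - a) * G N" "a * (G N - b)"]
          mult_left_mono[of "v (G N)" B "v (F N - a)"] v_nonneg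
        by (simp add: v_mult)
    qed
    then show "v (F N * G N - a * b) \<le> v (F N - a) * B + v a * v (G N - b)" for N .
    show "(\<lambda>N. v (F N - a) * B + v a * v (G N - b)) \<longlonglongrightarrow> 0"
      using tendsto_add[OF tendsto_mult_left_zero tendsto_mult_right_zero]
        f g unfolding val_sums_def val_tendsto_iff F_def G_def by fastforce
  qed
  have "(\<lambda>N. v (F N * G N - H N)) \<longlonglongrightarrow> 0"
  proof (rule LIMSEQ_I)
    fix \<epsilon> :: real
    assume "0 < \<epsilon>"
    \<comment> \<open>Whichever factor is below \<open>\<delta>\<close>, the other is at most
      \<open>A + B\<close>, so both cases give the bound \<open>\<epsilon> / 2\<close>.\<close>
    define \<delta> where "\<delta> = \<epsilon> / 2 / (A + B)"
    have "0 < A + B"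
      using A(1) B(1) by simp
    then have "0 < \<delta>"
      using \<open>0 < \<epsilon>\<close> by (simp add: \<delta>_def)
    have \<delta>: "\<delta> * (A + B) = \<epsilon> / 2"
      using \<open>0 < A + B\<close> \<delta>_def by (metis less_irrefl nonzero_eq_divide_eq)
    have "\<forall>\<^sub>F n in sequentially. v (f n) < \<delta> \<and> v (g n) < \<delta>"
      using order_tendstoD(2)[OF f0 \<open>0 < \<delta>\<close>] order_tendstoD(2)[OF g0 \<open>0 < \<delta>\<close>]
      by eventually_elim simp
    then obtain K where K: "\<And>n. n \<ge> K \<Longrightarrow> v (f n) < \<delta> \<and> v (g n) < \<delta>"
      unfolding eventually_sequentially by blast
    have "v (F N * G N - H N) \<le> \<epsilon> / 2" if N: "N \<ge> 2 * K" for N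
      unfolding FG
    proof (rule v_sum_le)
      fix z
      assume "z \<in> {(i,j). i < N \<and> j < N \<and> N \<le> i + j}"
      then obtain i j where z: "z = (i,j)" and ij: "K \<le> i \<or> K \<le> j"
        using N by fastforce
      from ij have "v (f i) * v (g j) \<le> \<delta> * (A + B)"
      proof
        assume "K \<le> i"
        then show ?thesis
          using K[of i] A B(1) B(2)[of j] v_nonneg[of "g j"] \<open>0 < \<delta>\<close>
          by (intro mult_mono) auto
      next
        assume "K \<le> j"
        then have "v (g j) * v (f i) \<le> \<delta> * (A + B)"
          using K[of j] B A(1) A(2)[of i] v_nonneg[of "f i"] \<open>0 < \<delta>\<close>
          by (intro mult_mono) auto
        then show ?thesis by (simp add: mult.commute)
      qed
      then show "v (case z of (i, j) \<Rightarrow> f i * g j) \<le> \<epsilon> / 2"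
        using \<delta> by (simp add: z v_mult)
    qed (use \<open>0 < \<epsilon>\<close> in simp)
    then show "\<exists>no. \<forall>N\<ge>no. norm (v (F N * G N - H N) - 0) < \<epsilon>"
      using \<open>0 < \<epsilon>\<close> by (intro exI[of _ "2 * K"]) (force simp: v_nonneg)
  qed
  then have "val_tendsto v (\<lambda>N. - 1 * (F N * G N - H N)) (- 1 * 0)"
    by (intro val_tendsto_mult_left) (simp add: val_tendsto_iff)
  from val_tendsto_add[OF FGlim this] show ?thesis
    by (simp add: val_sums_def H_def)
qed

lemma val_sums_fps_mult:
  assumes "val_sums v (\<lambda>n. fps_nth F n * u ^ n) a" and "val_sums v (\<lambda>n. fps_nth G n * u ^ n) b"
  shows "val_sums v (\<lambda>n. fps_nth (F * G) n * u ^ n) (a * b)"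
proof -
  have "fps_nth (F * G) n * u ^ n =
      (\<Sum>i\<le>n. fps_nth F i * u ^ i * (fps_nth G (n - i) * u ^ (n - i)))" for n
    unfolding fps_mult_nth atLeast0AtMost sum_distrib_right
  proof (intro sum.cong refl)
    fix i
    assume "i \<in> {..n}"
    then have "u ^ n = u ^ i * u ^ (n - i)"
      by (simp flip: power_add)
    then show "fps_nth F i * fps_nth G (n - i) * u ^ n =
        fps_nth F i * u ^ i * (fps_nth G (n - i) * u ^ (n - i))"
      by simp
  qed
  then show ?thesis
    using val_sums_Cauchy_product[OF assms] by simp
qed

text \<open>Dominated convergence for series: as \<open>\<epsilon> n\<close> does not depend on
  \<open>N\<close>, one cut-off \<open>M\<close> makes all tails small at once, and below it only
  finitely many limits are involved.\<close>

lemma val_tendsto_sums_swap: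
  assumes s: "\<And>N. val_sums v (f N) (s N)"
    and le: "\<And>N n. v (f N n) \<le> \<epsilon> n" and \<epsilon>: "\<epsilon> \<longlonglongrightarrow> 0"
    and g: "\<And>n. val_tendsto v (\<lambda>N. f N n) (g n)"
  shows "\<exists>S. val_sums v g S \<and> val_tendsto v s S"
proof -
  have g_le: "v (g n) \<le> \<epsilon> n" for n
    using val_tendsto_bound[OF g] le by simp
  then have "val_tendsto v g 0"
    by (intro val_tendsto_sandwich[OF _ \<epsilon>]) simp
  then have "(\<lambda>n. v (g n)) \<longlonglongrightarrow> 0"
    by (simp add: val_tendsto_iff)
  then obtain S where S: "val_sums v g S"
    using val_summable by blast
  have "(\<lambda>N. v (s N - S)) \<longlonglongrightarrow> 0"
  proof (rule LIMSEQ_I)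
    fix \<delta> :: real
    assume "0 < \<delta>"
    then obtain M where M: "\<And>n. n \<ge> M \<Longrightarrow> \<epsilon> n < \<delta> / 2"
      using order_tendstoD(2)[OF \<epsilon>, of "\<delta> / 2"] unfolding eventually_sequentially by auto
    have "(\<lambda>N. v ((\<Sum>n<M. f N n) - (\<Sum>n<M. g n))) \<longlonglongrightarrow> 0"
      using val_tendsto_sum[of "{..<M}" "\<lambda>n N. f N n" g] g by (simp add: val_tendsto_iff)
    from order_tendstoD(2)[OF this, of "\<delta> / 2"] \<open>0 < \<delta>\<close>
    obtain K where K: "\<And>N. N \<ge> K \<Longrightarrow> v ((\<Sum>n<M. f N n) - (\<Sum>n<M. g n)) < \<delta> / 2"
      unfolding eventually_sequentially by auto
    have "v (s N - S) < \<delta>" if "N \<ge> K" for N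
    proof -
      define X Y Z where "X = s N - (\<Sum>n<M. f N n)" and "Y = S - (\<Sum>n<M. g n)"
        and "Z = (\<Sum>n<M. f N n) - (\<Sum>n<M. g n)"
      have "v (f N n) \<le> \<delta> / 2" if "n \<ge> M" for n
        using le[of N n] M[OF that] by linarith
      then have "v X \<le> \<delta> / 2"
        unfolding X_def by (rule val_sums_tail_le[OF s]) (use \<open>0 < \<delta>\<close> in simp_all)
      moreover have "v (g n) \<le> \<delta> / 2" if "n \<ge> M" for n
        using g_le[of n] M[OF that] by linarith
      then have "v Y \<le> \<delta> / 2"
        unfolding Y_def by (rule val_sums_tail_le[OF S]) (use \<open>0 < \<delta>\<close> in simp_all)
      moreover have "v Z < \<delta> / 2"
        unfolding Z_def using K[OF that] .
      ultimately have "v (X - Y + Z) < \<delta>"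
        using v_ultrametric[of "X - Y" Z] v_diff[of X Y] \<open>0 < \<delta>\<close> by linarith
      then show ?thesis
        by (simp add: X_def Y_def Z_def)
    qed
    then show "\<exists>no. \<forall>N\<ge>no. norm (v (s N - S) - 0) < \<delta>"
      by (auto simp: v_nonneg)
  qed
  then have "val_tendsto v s S"
    by (simp only: val_tendsto_iff)
  with S show ?thesis by blast
qed

text \<open>The entries with \<open>n < m\<close> vanish, so the triangle up to \<open>M\<close> has
  the same sum as the square. Each row sum differs from its part inside the square by a tail, which
  the majorant \<open>\<epsilon>\<close> controls uniformly in \<open>m\<close>.\<close>

lemma val_sums_swap_triangular:
  assumes s: "\<And>m. val_sums v (a m) (s m)" and S: "val_sums v s S"
    and triangular: "\<And>m n. n < m \<Longrightarrow> a m n = 0"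
    and le: "\<And>m n. v (a m n) \<le> \<epsilon> n" and \<epsilon>: "\<epsilon> \<longlonglongrightarrow> 0"
  shows "val_sums v (\<lambda>n. \<Sum>m\<le>n. a m n) S"
proof -
  have eq: "(\<Sum>n<M. \<Sum>m\<le>n. a m n) = (\<Sum>m<M. \<Sum>n<M. a m n)" for M
  proof -
    have "(\<Sum>m\<le>n. a m n) = (\<Sum>m<M. a m n)" if "n < M" for n
      using that triangular by (intro sum.mono_neutral_left) auto
    then have "(\<Sum>n<M. \<Sum>m\<le>n. a m n) = (\<Sum>n<M. \<Sum>m<M. a m n)"
      by simp
    also have "\<dots> = (\<Sum>m<M. \<Sum>n<M. a m n)"
      by (rule sum.swap)
    finally show ?thesis .
  qed
  have "(\<lambda>M. v ((\<Sum>m<M. s m) - (\<Sum>n<M. \<Sum>m\<le>n. a m n))) \<longlonglongrightarrow> 0"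
  proof (rule LIMSEQ_I)
    fix \<delta> :: real
    assume "0 < \<delta>"
    then obtain K where K: "\<And>n. n \<ge> K \<Longrightarrow> \<epsilon> n < \<delta> / 2"
      using order_tendstoD(2)[OF \<epsilon>, of "\<delta> / 2"] unfolding eventually_sequentially by auto
    have "v ((\<Sum>m<M. s m) - (\<Sum>n<M. \<Sum>m\<le>n. a m n)) \<le> \<delta> / 2" if "M \<ge> K" for M
    proof -
      have "v (a m n) \<le> \<delta> / 2" if "n \<ge> M" for m n
        using le[of m n] K[of n] that \<open>M \<ge> K\<close> by linarith
      then have "v (s m - (\<Sum>n<M. a m n)) \<le> \<delta> / 2" for m
        using \<open>0 < \<delta>\<close> by (intro val_sums_tail_le[OF s]) auto
      then show ?thesis
        unfolding eq sum_subtractf [symmetric] using \<open>0 < \<delta>\<close> by (intro v_sum_le) auto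
    qed
    then show "\<exists>no. \<forall>M\<ge>no. norm (v ((\<Sum>m<M. s m) - (\<Sum>n<M. \<Sum>m\<le>n. a m n)) - 0) < \<delta>"
      using \<open>0 < \<delta>\<close> by (intro exI[of _ K]) (force simp: v_nonneg)
  qed
  then have "val_tendsto v (\<lambda>M. - 1 * ((\<Sum>m<M. s m) - (\<Sum>n<M. \<Sum>m\<le>n. a m n))) (- 1 * 0)"
    by (intro val_tendsto_mult_left) (simp add: val_tendsto_iff)
  from val_tendsto_add[OF S[unfolded val_sums_def] this] show ?thesis
    by (simp add: val_sums_def)
qed

end


section \<open>Logarithm, exponential and Stirling numbers\<close>

definition signed_stirling :: "nat \<Rightarrow> nat \<Rightarrow> 'a::comm_ring_1" where
  "signed_stirling n m = (- 1) ^ (n + m) * of_nat (stirling n m)"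

lemma signed_stirling_0_0 [simp]: "signed_stirling 0 0 = 1"
  and signed_stirling_Suc_0 [simp]: "signed_stirling (Suc n) 0 = 0"
  and signed_stirling_less [simp]: "n < m \<Longrightarrow> signed_stirling n m = 0"
  by (simp_all add: signed_stirling_def)

lemma signed_stirling_Suc_Suc:
  "signed_stirling (Suc n) (Suc m) =
    signed_stirling n m - of_nat n * (signed_stirling n (Suc m) :: 'a::comm_ring_1)"
  by (simp add: signed_stirling_def algebra_simps)

text \<open>The sum is the falling factorial 1 (1 - 1) (1 - 2) ... with \<open>n\<close> factors,
  which vanishes from \<open>n = 2\<close> on. It makes the series of exp(log(1 + u))
  terminate.\<close>

lemma sum_signed_stirling:
  "(\<Sum>m\<le>n. signed_stirling n m) = (if n \<le> 1 then 1 else 0 :: 'a::comm_ring_1)"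
proof (induction n)
  case (Suc n)
  have "(\<Sum>m\<le>Suc n. signed_stirling (Suc n) m) =
      (\<Sum>m\<le>n. signed_stirling n m) - of_nat n * (\<Sum>m\<le>n. signed_stirling n (Suc m) :: 'a)"
    unfolding sum.atMost_Suc_shift
    by (simp add: signed_stirling_Suc_Suc sum_subtractf sum_distrib_left)
  also have "(\<Sum>m\<le>n. signed_stirling n (Suc m) :: 'a) =
      (\<Sum>m\<le>n. signed_stirling n m) - signed_stirling n 0"
    using sum.atMost_Suc_shift[of "signed_stirling n :: nat \<Rightarrow> 'a" n] by simp
  finally show ?case
    unfolding Suc.IH by (cases n) auto
qed simp

text \<open>Orthogonality of the two kinds, on which the final inversion rests. The recurrence of
  \<open>Stirling\<close> followed by that of \<open>signed_stirling\<close> reduces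
  \<open>(n + 1, k)\<close> to \<open>(n, k - 1)\<close>.\<close>

lemma sum_Stirling_signed_stirling:
  "(\<Sum>m\<le>n. of_nat (Stirling n m) * signed_stirling m k) =
    (if n = k then 1 else 0 :: 'a::comm_ring_1)"
proof (induction n arbitrary: k)
  case 0
  then show ?case by (cases k) auto
next
  case (Suc n)
  let ?S = "\<lambda>n m. of_nat (Stirling n m) :: 'a"
  have "(\<Sum>m\<le>Suc n. ?S (Suc n) m * signed_stirling m k) =
      (\<Sum>m\<le>n. ?S (Suc n) (Suc m) * signed_stirling (Suc m) k)"
    unfolding sum.atMost_Suc_shift by simp
  also have "\<dots> = (\<Sum>m\<le>n. ?S n (Suc m) * (of_nat (Suc m) * signed_stirling (Suc m) k)) +
      (\<Sum>m\<le>n. ?S n m * signed_stirling (Suc m) k)"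
    unfolding sum.distrib [symmetric] by (intro sum.cong refl) (simp add: algebra_simps)
  \<comment> \<open>The shift changes nothing at the ends: the term at 0 has the factor
    \<open>of_nat 0\<close>, and the one at \<open>n + 1\<close> has
    \<open>Stirling n (Suc n) = 0\<close>.\<close>
  also have "(\<Sum>m\<le>n. ?S n (Suc m) * (of_nat (Suc m) * signed_stirling (Suc m) k)) =
      (\<Sum>m\<le>n. ?S n m * (of_nat m * signed_stirling m k))"
    using sum.atMost_Suc_shift[of "\<lambda>m. ?S n m * (of_nat m * signed_stirling m k)" n] by simp
  also have "\<dots> + (\<Sum>m\<le>n. ?S n m * signed_stirling (Suc m) k) =
      (\<Sum>m\<le>n. ?S n m * (of_nat m * signed_stirling m k + signed_stirling (Suc m) k))"
    unfolding sum.distrib [symmetric] by (intro sum.cong refl) (simp add: algebra_simps)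
  also have "\<dots> = (if Suc n = k then 1 else 0)"
  proof (cases k)
    case 0
    have "of_nat m * signed_stirling m 0 = (0 :: 'a)" for m
      by (cases m) simp_all
    then show ?thesis
      using 0 by simp
  next
    case (Suc k')
    then show ?thesis
      using Suc.IH[of k'] by (simp add: signed_stirling_Suc_Suc)
  qed
  finally show ?case .
qed

section \<open>The formal power series log(1 + X)^m / m!\<close>

definition fps_log_power :: "nat \<Rightarrow> 'a::field_char_0 fps" where
  "fps_log_power m = Abs_fps (\<lambda>n. signed_stirling n m / fact n)"

lemma fps_nth_log_power [simp]:
  "fps_nth (fps_log_power m) n = signed_stirling n m / fact n"
  by (simp add: fps_log_power_def)

lemma fps_log_power_0: "fps_log_power 0 = 1"
proof (rule fps_ext)
  fix n
  show "fps_nth (fps_log_power 0) n = fps_nth 1 n"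
    by (cases n) simp_all
qed

text \<open>The recurrence of the signed Stirling numbers, read as the differential equation
  satisfied by log(1 + X)^m / m!.\<close>

lemma fps_log_power_deriv:
  "(1 + fps_X) * fps_deriv (fps_log_power (Suc m)) = (fps_log_power m :: 'a::field_char_0 fps)"
proof (rule fps_ext)
  fix n
  have d: "fps_nth (fps_deriv (fps_log_power (Suc m))) n =
      (signed_stirling (Suc n) (Suc m) / fact n :: 'a)" for n
    by (simp add: field_simps del: of_nat_Suc)
  have x: "fps_nth (fps_X * fps_deriv (fps_log_power (Suc m))) n =
      (of_nat n * signed_stirling n (Suc m) / fact n :: 'a)"
  proof (cases n)
    case (Suc k)
    then show ?thesis
      by (simp add: d field_simps del: of_nat_Suc fps_deriv_nth)
  qed simp
  show "fps_nth ((1 + fps_X) * fps_deriv (fps_log_power (Suc m))) n =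
      (fps_nth (fps_log_power m) n :: 'a)"
    unfolding distrib_right fps_add_nth x mult_1_left d
    by (simp add: signed_stirling_Suc_Suc field_simps)
qed

text \<open>Both sides have constant term 0 and, by the differential equation and the induction
  hypothesis, the same derivative. This identifies the series as divided powers of the
  logarithm.\<close>

lemma fps_log_power_mult:
  "fps_log_power 1 * fps_log_power m = of_nat (Suc m) * (fps_log_power (Suc m) :: 'a::field_char_0 fps)"
proof (induction m)
  case 0
  then show ?case by (simp add: fps_log_power_0)
next
  case (Suc m)
  define D where "D = fps_log_power 1 * fps_log_power (Suc m) -
    of_nat (Suc (Suc m)) * (fps_log_power (Suc (Suc m)) :: 'a fps)"
  have "(1 + fps_X) * fps_deriv D =
      ((1 + fps_X) * fps_deriv (fps_log_power (Suc 0))) * fps_log_power (Suc m) +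
      fps_log_power 1 * ((1 + fps_X) * fps_deriv (fps_log_power (Suc m))) -
      of_nat (Suc (Suc m)) * ((1 + fps_X) * fps_deriv (fps_log_power (Suc (Suc m))))"
    unfolding D_def fps_deriv_sub fps_deriv_mult fps_deriv_of_nat
    by (simp add: algebra_simps del: of_nat_Suc)
  also have "\<dots> = 0"
    unfolding fps_log_power_deriv fps_log_power_0 Suc.IH by (simp add: algebra_simps)
  finally have "(1 + fps_X) * fps_deriv D = 0" .
  \<comment> \<open>Formal power series form an integral domain, so the nonzero factor
    \<open>1 + fps_X\<close> can be cancelled.\<close>
  moreover have "fps_nth (1 + fps_X :: 'a fps) 0 \<noteq> fps_nth 0 0"
    by simp
  ultimately have "fps_deriv D = 0"
    by (metis mult_eq_0_iff)
  moreover have "fps_nth D 0 = 0"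
    by (simp add: D_def)
  ultimately have "D = 0"
    by (simp add: fps_deriv_eq_0_iff)
  then show ?case
    by (simp add: D_def)
qed

context padic_complex
begin

section \<open>The p-adic logarithm and exponential\<close>

lemma v_signed_stirling_le_1: "v (signed_stirling n m) \<le> 1"
  unfolding signed_stirling_def
  by (intro v_mult_le_1 v_power_le_1 v_of_nat_le_1) (simp add: v_minus v_1)

text \<open>The coefficient \<open>signed_stirling (Suc n) 1 / fact (Suc n)\<close> is
  \<open>(- 1) ^ n / (n + 1)\<close>, the one in \<open>padic_log\<close>. The estimate holds
  because every single term is at most \<open>v u\<close>.\<close>

lemma padic_log_sums:
  assumes "v u < r"
  shows "val_sums v (\<lambda>n. fps_nth (fps_log_power 1) n * u ^ n) (padic_log v (1 + u))"
    and "v (padic_log v (1 + u)) \<le> v u"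
proof -
  define f where "f = (\<lambda>n. fps_nth (fps_log_power 1) n * u ^ n)"
  have le: "v (f n) \<le> v u ^ n / v (fact n)" for n
    using v_mult_le[OF v_signed_stirling_le_1[of n 1], of "u ^ n"] v_nonneg
    by (simp add: f_def v_mult v_divide v_power divide_right_mono)
  have "signed_stirling (Suc n) 1 = ((- 1) ^ n * fact n :: 'a)" for n
    by (simp add: signed_stirling_def stirling_Suc_n_1 del: stirling.simps)
  then have f_Suc: "f (Suc n) = (- 1) ^ n * (1 + u - 1) ^ Suc n / of_nat (Suc n)" for n
    by (simp add: f_def field_simps del: of_nat_Suc)
  have "val_tendsto v (\<lambda>n. f (Suc n)) 0"
    by (rule val_tendsto_sandwich[OF _ LIMSEQ_Suc[OF power_div_v_fact_tendsto_0[OF v_nonneg assms]]])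
      (use le in \<open>simp del: fact_Suc power_Suc\<close>)
  then obtain s where s: "val_sums v (\<lambda>n. f (Suc n)) s"
    using val_summable[of "\<lambda>n. f (Suc n)"] by (auto simp: val_tendsto_iff)
  moreover have "padic_log v (1 + u) = s"
    using val_suminf_eq[OF s] unfolding padic_log_def f_Suc .
  moreover have "f 0 = 0"
    by (simp add: f_def)
  ultimately have sums: "val_sums v f (padic_log v (1 + u))"
    using val_sums_Suc[of f s] by simp
  then show "val_sums v (\<lambda>n. fps_nth (fps_log_power 1) n * u ^ n) (padic_log v (1 + u))"
    unfolding f_def .
  have "v (f n) \<le> v u" for n
    using \<open>f 0 = 0\<close> le[of n] power_div_v_fact_le[OF v_nonneg assms, of n] v_nonneg[of u]
    by (cases "n = 0") auto
  then show "v (padic_log v (1 + u)) \<le> v u"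
    using val_sums_tail_le[OF sums, of 0 "v u"] v_nonneg by simp
qed

text \<open>Carries the formal product rule over to values: multiply by the logarithm series once
  more and divide by \<open>m + 1\<close>.\<close>

lemma padic_log_power_sums:
  assumes "v u < r"
  shows "val_sums v (\<lambda>n. fps_nth (fps_log_power m) n * u ^ n) (padic_log v (1 + u) ^ m / fact m)"
proof (induction m)
  case 0
  have "val_sums v (\<lambda>n. fps_nth 1 n * u ^ n) (\<Sum>n<1. fps_nth 1 n * u ^ n)"
    by (rule val_sums_finite) simp
  then show ?case
    by (simp add: fps_log_power_0)
next
  case (Suc m)
  have "val_sums v (\<lambda>n. 1 / of_nat (Suc m) *
      (fps_nth (of_nat (Suc m) * fps_log_power (Suc m)) n * u ^ n))
      (1 / of_nat (Suc m) * (padic_log v (1 + u) * (padic_log v (1 + u) ^ m / fact m)))"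
    unfolding fps_log_power_mult [symmetric]
    by (intro val_sums_mult_left val_sums_fps_mult padic_log_sums assms Suc.IH)
  moreover have "1 / of_nat (Suc m) * (fps_nth (of_nat (Suc m) * fps_log_power (Suc m)) n * u ^ n) =
      fps_nth (fps_log_power (Suc m)) n * u ^ n" for n
    unfolding fps_of_nat [symmetric] fps_mult_left_const_nth
    by (simp del: of_nat_Suc)
  ultimately show ?case
    by (simp add: field_simps del: of_nat_Suc fps_nth_log_power)
qed

lemma padic_exp_sums:
  assumes "v x < r"
  shows "val_sums v (\<lambda>n. x ^ n / fact n) (padic_exp v x)"
    and "v (padic_exp v x - 1) \<le> v x"
proof -
  obtain s where s: "val_sums v (\<lambda>n. x ^ n / fact n) s"
    using val_summable[of "\<lambda>n. x ^ n / fact n"] power_div_v_fact_tendsto_0[OF v_nonneg assms]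
    by (auto simp: v_divide v_power)
  then show sums: "val_sums v (\<lambda>n. x ^ n / fact n) (padic_exp v x)"
    using val_suminf_eq[OF s] by (simp add: padic_exp_def)
  have "v (x ^ n / fact n) \<le> v x" if "n \<ge> 1" for n
    using power_div_v_fact_le[OF v_nonneg assms, of n] that by (simp add: v_divide v_power)
  then show "v (padic_exp v x - 1) \<le> v x"
    using val_sums_tail_le[OF sums, of 1 "v x"] v_nonneg by simp
qed

text \<open>The Cauchy product of the two series is the series of the sum, by the binomial
  theorem.\<close>

lemma padic_exp_add:
  assumes "v x < r" and "v y < r"
  shows "padic_exp v (x + y) = padic_exp v x * padic_exp v y"
proof -
  have "(\<Sum>i\<le>n. x ^ i / fact i * (y ^ (n - i) / fact (n - i))) = (x + y) ^ n / fact n" for n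
    unfolding binomial_ring sum_divide_distrib
    by (intro sum.cong refl) (simp add: binomial_fact field_simps)
  then have "val_sums v (\<lambda>n. (x + y) ^ n / fact n) (padic_exp v x * padic_exp v y)"
    using val_sums_Cauchy_product[OF padic_exp_sums(1)[OF assms(1)] padic_exp_sums(1)[OF assms(2)]]
    by simp
  then show ?thesis
    by (simp add: padic_exp_def val_suminf_eq)
qed

lemma padic_exp_0: "padic_exp v 0 = 1"
  using padic_exp_sums(2)[of 0] padic_radius_pos v_nonneg[of "padic_exp v 0 - 1"]
    v_eq_0_iff[of "padic_exp v 0 - 1"] by simp

text \<open>The binomial series of (1 + u)^c, with the falling factorial of \<open>c\<close> written
  in powers of \<open>c\<close>. It arises by inserting the series of log(1 + u)^m / m! into the
  exponential series and exchanging the two summations.\<close>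

lemma padic_exp_log_sums:
  assumes u: "v u < r" and cu: "v (c * u) < r"
  shows "val_sums v (\<lambda>n. u ^ n / fact n * (\<Sum>m\<le>n. signed_stirling n m * c ^ m))
    (padic_exp v (c * padic_log v (1 + u)))"
proof -
  define L where "L = padic_log v (1 + u)"
  define R where "R = max (v u) (v (c * u))"
  define a where "a = (\<lambda>m n. c ^ m * (fps_nth (fps_log_power m) n * u ^ n))"
  have "v (c * L) \<le> v (c * u)"
    using padic_log_sums(2)[OF u] v_nonneg[of c] by (simp add: L_def v_mult mult_left_mono)
  then have L: "v (c * L) < r"
    using cu by simp
  have R: "0 \<le> R" "R < r"
    using u cu v_nonneg[of u] by (auto simp: R_def)
  have a_le: "v (a m n) \<le> R ^ n / v (fact n)" for m n
  proof (cases "n < m")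
    case False
    \<comment> \<open>Since \<open>v c\<close> may exceed 1, each \<open>c\<close> is paired with a
      \<open>u\<close>; every factor is then at most \<open>R\<close>.\<close>
    then have "c ^ m * u ^ n = (c * u) ^ m * u ^ (n - m)"
      by (simp add: power_mult_distrib flip: power_add)
    then have "a m n = signed_stirling n m * ((c * u) ^ m * u ^ (n - m)) / fact n"
      by (simp add: a_def)
    then have "v (a m n) \<le> v (c * u) ^ m * v u ^ (n - m) / v (fact n)"
      using v_mult_le[OF v_signed_stirling_le_1[of n m], of "(c * u) ^ m * u ^ (n - m)"] v_nonneg
      by (simp only: v_divide v_mult v_power) (rule divide_right_mono)
    also have "\<dots> \<le> R ^ m * R ^ (n - m) / v (fact n)"
      using v_nonneg R by (intro divide_right_mono mult_mono power_mono) (auto simp: R_def)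
    also have "\<dots> = R ^ n / v (fact n)"
      using False by (simp flip: power_add)
    finally show ?thesis .
  qed (use R v_nonneg in \<open>simp add: a_def\<close>)
  have a_sums: "val_sums v (a m) ((c * L) ^ m / fact m)" for m
    using val_sums_mult_left[OF padic_log_power_sums[OF u, of m], of "c ^ m"]
    by (simp add: a_def L_def power_mult_distrib)
  have "val_sums v (\<lambda>n. \<Sum>m\<le>n. a m n) (padic_exp v (c * L))"
    by (rule val_sums_swap_triangular[OF a_sums padic_exp_sums(1)[OF L] _ a_le
          power_div_v_fact_tendsto_0[OF R]]) (simp add: a_def)
  moreover have "(\<Sum>m\<le>n. a m n) = u ^ n / fact n * (\<Sum>m\<le>n. signed_stirling n m * c ^ m)" for n
    by (simp add: a_def sum_distrib_left mult_ac)
  ultimately show ?thesis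
    by (simp add: L_def)
qed

lemma padic_exp_log:
  assumes "v u < r"
  shows "padic_exp v (padic_log v (1 + u)) = 1 + u"
proof -
  have "val_sums v (\<lambda>n. u ^ n / fact n * (if n \<le> 1 then 1 else 0)) (padic_exp v (padic_log v (1 + u)))"
    using padic_exp_log_sums[of u 1] assms sum_signed_stirling[where 'a = 'a] by simp
  moreover have "val_sums v (\<lambda>n. u ^ n / fact n * (if n \<le> 1 then 1 else 0))
      (\<Sum>n<2. u ^ n / fact n * (if n \<le> 1 then 1 else 0))"
    by (rule val_sums_finite) simp
  ultimately have "padic_exp v (padic_log v (1 + u)) =
      (\<Sum>n<2. u ^ n / fact n * (if n \<le> 1 then 1 else 0))"
    unfolding val_sums_def by (rule val_tendsto_unique)
  then show ?thesis
    by (simp add: numeral_2_eq_2)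
qed

end


section \<open>Riemann sums of the q-integral\<close>

definition geom_sum :: "'a::comm_ring_1 \<Rightarrow> nat \<Rightarrow> 'a" where
  "geom_sum q n = (\<Sum>i<n. q ^ i)"

lemma geom_sum_add: "geom_sum q (m + n) = geom_sum q m + q ^ m * geom_sum q n"
  unfolding geom_sum_def
  by (induction n) (simp_all add: power_add algebra_simps)

lemma geom_sum_mult: "geom_sum q (m * n) = geom_sum q m * geom_sum (q ^ m) n"
proof (induction n)
  case (Suc n)
  have "geom_sum q (m * Suc n) = geom_sum q (m * n) + q ^ (m * n) * geom_sum q m"
    using geom_sum_add[of q "m * n" m] by (simp add: add.commute)
  then show ?case
    unfolding Suc.IH by (simp add: geom_sum_def power_mult algebra_simps)
qed (simp add: geom_sum_def)

lemma one_diff_mult_geom_sum: "(1 - q) * geom_sum q n = 1 - q ^ n"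
  unfolding geom_sum_def by (rule one_diff_power_eq [symmetric])

text \<open>This is \<open>((1 + u) ^ n - 1) / u\<close> expanded. Induction with Pascal's rule
  avoids the division and so includes \<open>u = 0\<close>.\<close>

lemma geom_sum_binomial: "geom_sum (1 + u) n = (\<Sum>k<n. of_nat (n choose Suc k) * u ^ k)"
proof (induction n)
  case (Suc n)
  have "(1 + u) ^ n = (\<Sum>k\<le>n. of_nat (n choose k) * u ^ k)"
    using binomial_ring[of u 1 n] by (simp add: add.commute)
  moreover have "(\<Sum>k<n. of_nat (n choose Suc k) * u ^ k) = (\<Sum>k\<le>n. of_nat (n choose Suc k) * u ^ k)"
    by (simp add: binomial_eq_0 flip: lessThan_Suc_atMost)
  ultimately have "geom_sum (1 + u) (Suc n) =
      (\<Sum>k\<le>n. of_nat (n choose Suc k) * u ^ k) + (\<Sum>k\<le>n. of_nat (n choose k) * u ^ k)"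
    using Suc.IH by (simp add: geom_sum_def)
  then show ?case
    unfolding lessThan_Suc_atMost sum.distrib [symmetric] by (simp add: algebra_simps)
qed (simp add: geom_sum_def)

lemma sum_lessThan_mult:
  fixes f :: "nat \<Rightarrow> 'b::comm_monoid_add"
  shows "(\<Sum>y<m * n. f y) = (\<Sum>k<n. \<Sum>y<m. f (m * k + y))"
proof (induction n)
  case (Suc n)
  have "(\<Sum>y<m * n + k. f y) = (\<Sum>y<m * n. f y) + (\<Sum>y<k. f (m * n + y))" for k
    by (induction k) (simp_all add: add.assoc)
  then show ?case
    using Suc.IH by (simp add: add.commute)
qed simp

context padic_complex
begin

text \<open>Taylor expansion to second order with an integral remainder, for comparing consecutive
  Riemann sums.\<close>

lemma power_add_expand:
  assumes z: "v z \<le> 1" and h: "v h \<le> 1"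
  shows "\<exists>R. v R \<le> 1 \<and> (z + h) ^ m = z ^ m + of_nat m * z ^ (m - 1) * h + h ^ 2 * R"
proof (induction m)
  case 0
  show ?case
    by (intro exI[of _ 0]) simp
next
  case (Suc m)
  then obtain R where R: "v R \<le> 1"
    "(z + h) ^ m = z ^ m + of_nat m * z ^ (m - 1) * h + h ^ 2 * R" by blast
  have "v ((z + h) * R) \<le> 1"
    using v_ultrametric[of z h] z h R(1) by (intro v_mult_le_1) auto
  moreover have "v (of_nat m * z ^ (m - 1)) \<le> 1"
    using z by (intro v_mult_le_1 v_of_nat_le_1 v_power_le_1)
  ultimately have "v (of_nat m * z ^ (m - 1) + (z + h) * R) \<le> 1"
    using v_ultrametric[of "of_nat m * z ^ (m - 1)" "(z + h) * R"] by linarith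
  moreover have "(z + h) ^ Suc m = z ^ Suc m + of_nat (Suc m) * z ^ m * h +
      h ^ 2 * (of_nat m * z ^ (m - 1) + (z + h) * R)"
    unfolding power_Suc[of "z + h"] R(2)
    by (cases m) (simp_all add: algebra_simps power2_eq_square)
  ultimately show ?case
    by auto
qed

text \<open>In the binomial expansion the constant term \<open>p\<close> dominates: the middle terms
  carry \<open>p\<close> and at least one \<open>u\<close>, and the last one is
  \<open>u ^ (p - 1)\<close>, smaller than \<open>r ^ (p - 1) = 1 / p\<close>.\<close>

lemma v_geom_sum_p:
  assumes "v u < r"
  shows "v (geom_sum (1 + u) p) = 1 / real p"
proof -
  have "v (\<Sum>k=1..<p. of_nat (p choose Suc k) * u ^ k) \<le> max (1 / real p * v u) (v u ^ (p - 1))"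
  proof (rule v_sum_le)
    fix k
    assume k: "k \<in> {1..<p}"
    show "v (of_nat (p choose Suc k) * u ^ k) \<le> max (1 / real p * v u) (v u ^ (p - 1))"
    proof (cases "Suc k = p")
      case True
      then show ?thesis
        by (simp add: v_power flip: True)
    next
      case False
      then have "p dvd (p choose Suc k)"
        using k prime_p by (intro dvd_choose_prime) auto
      then obtain c where c: "p choose Suc k = p * c" by blast
      have "v (of_nat (p choose Suc k)) \<le> 1 / real p"
        using v_of_nat_le_1[of c] p_gt_1 by (simp add: c v_mult v_p divide_right_mono)
      moreover have "v u ^ k \<le> v u ^ 1"
        using assms padic_radius_less_1 k v_nonneg by (intro power_decreasing) auto
      ultimately have "v (of_nat (p choose Suc k) * u ^ k) \<le> 1 / real p * v u"
        unfolding v_mult v_power using v_nonneg by (intro mult_mono) auto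
      then show ?thesis by simp
    qed
  next
    show "0 \<le> max (1 / real p * v u) (v u ^ (p - 1))"
      using v_nonneg by (simp add: le_max_iff_disj)
  qed
  also have "\<dots> < 1 / real p"
  proof -
    have "v u ^ (p - 1) < r ^ (p - 1)"
      using assms v_nonneg p_gt_1 by (intro power_strict_mono) auto
    moreover have "1 / real p * v u < 1 / real p * 1"
      using assms padic_radius_less_1 p_gt_1 by (intro mult_strict_left_mono) auto
    ultimately show ?thesis
      by (simp only: padic_radius_power max_less_iff_conj mult_1_right)
  qed
  finally have "v ((\<Sum>k=1..<p. of_nat (p choose Suc k) * u ^ k) + of_nat p) = v (of_nat p)"
    by (intro v_add_eq) (simp add: v_p)
  moreover have "geom_sum (1 + u) p = (\<Sum>k=1..<p. of_nat (p choose Suc k) * u ^ k) + of_nat p"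
    unfolding geom_sum_binomial lessThan_atLeast0
    using p_gt_1 by (subst sum.atLeast_Suc_lessThan) simp_all
  ultimately show ?thesis
    by (simp add: v_p)
qed

end

section \<open>The q-numbers \<open>[x + y]\<close> for natural \<open>y\<close>\<close>

locale carlitz_setting = padic_complex p v for p and v :: "'a::field_char_0 \<Rightarrow> real" +
  fixes q x :: 'a
  assumes q: "v (q - 1) < padic_radius p" and x: "v x \<le> 1"
begin

lemma v_q: "v q = 1"
  using v_add_eq[of "q - 1" 1] q padic_radius_less_1 by (simp add: v_1)

lemma v_log_q: "v (padic_log v q) \<le> v (q - 1)"
  using padic_log_sums(2)[OF q] by simp

lemma v_mult_log_q: "v z \<le> 1 \<Longrightarrow> v (z * padic_log v q) < r"
  using v_mult_le[of z "padic_log v q"] v_log_q q by linarith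

text \<open>Additivity of the exponential reduces this to exp(log q) = q.\<close>

lemma q_power_of_nat: "q_power v q (of_nat y) = q ^ y"
proof (induction y)
  case 0
  then show ?case by (simp add: q_power_def padic_exp_0)
next
  case (Suc y)
  have "q_power v q (of_nat (Suc y)) = padic_exp v (padic_log v q + of_nat y * padic_log v q)"
    by (simp add: q_power_def algebra_simps)
  also have "\<dots> = padic_exp v (padic_log v q) * q_power v q (of_nat y)"
    using v_mult_log_q[of 1] v_mult_log_q[OF v_of_nat_le_1]
    by (simp add: q_power_def padic_exp_add v_1)
  finally show ?case
    using Suc.IH padic_exp_log[OF q] by simp
qed

lemma q_power_add: "q_power v q (x + of_nat y) = q_power v q x * q ^ y"
proof -
  have "q_power v q (x + of_nat y) = q_power v q x * q_power v q (of_nat y)"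
    using v_mult_log_q[OF x] v_mult_log_q[OF v_of_nat_le_1]
    by (simp add: q_power_def padic_exp_add distrib_right)
  then show ?thesis
    by (simp add: q_power_of_nat)
qed

lemma q_number_of_nat: "q_number v q (of_nat n) = geom_sum q n"
proof (cases "q = 1")
  case False
  then show ?thesis
    using one_diff_mult_geom_sum[of q n]
    by (simp add: q_number_def q_power_of_nat field_simps)
qed (simp add: q_number_def geom_sum_def)

lemma q_power_1_left: "q_power v 1 z = 1"
proof -
  have "v (padic_log v 1) \<le> 0"
    using padic_log_sums(2)[of 0] padic_radius_pos by simp
  then have "padic_log v 1 = 0"
    using v_nonneg[of "padic_log v 1"] v_eq_0_iff[of "padic_log v 1"] by simp
  then show ?thesis
    by (simp add: q_power_def padic_exp_0)
qed

text \<open>For \<open>q = 1\<close> both sides are 1, so no case split is needed when a q-power is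
  rewritten through a q-number.\<close>

lemma q_power_eq: "q_power v q z = 1 - (1 - q) * q_number v q z"
  by (simp add: q_number_def q_power_1_left)

abbreviation z :: "nat \<Rightarrow> 'a" where
  "z y \<equiv> q_number v q (x + of_nat y)"

lemma q_number_add: "z (m + y) = z y + q_power v q (x + of_nat y) * geom_sum q m"
proof (cases "q = 1")
  case False
  have "(1 - q) * z (m + y) = (1 - q) * (z y + q_power v q (x + of_nat y) * geom_sum q m)"
    using one_diff_mult_geom_sum[of q m] False q_power_add[of y] q_power_add[of "m + y"]
    by (simp add: q_number_def distrib_left mult.left_commute[of "1 - q"])
      (simp add: power_add algebra_simps)
  then show ?thesis
    using False by simp
qed (simp add: q_number_def q_power_1_left geom_sum_def)

text \<open>For \<open>q \<noteq> 1\<close> the exponent \<open>(x + y) * log q\<close>, and with it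
  the exponential minus 1, is at most \<open>v (q - 1)\<close>, the size of the denominator.\<close>

lemma v_q_number_le_1: "v (z y) \<le> 1"
proof (cases "q = 1")
  case True
  then show ?thesis
    using x v_ultrametric[of x "of_nat y"] v_of_nat_le_1[of y] by (simp add: q_number_def)
next
  case False
  have "v (x + of_nat y) \<le> 1"
    using x v_ultrametric[of x "of_nat y"] v_of_nat_le_1[of y] by linarith
  then have "v ((x + of_nat y) * padic_log v q) \<le> v (q - 1)"
    using v_mult_le[of _ "padic_log v q"] v_log_q order_trans by blast
  then have "v (q_power v q (x + of_nat y) - 1) \<le> v (q - 1)"
    using padic_exp_sums(2)[of "(x + of_nat y) * padic_log v q"] q unfolding q_power_def by linarith
  then show ?thesis
    using False v_minus_commute[of 1] v_pos[of "q - 1"]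
    by (simp add: q_number_def v_divide)
qed

lemma v_q_power_le_1: "v (q_power v q (x + of_nat y)) \<le> 1"
proof -
  have "v (1 - q) \<le> 1"
    using q padic_radius_less_1 v_minus_commute[of q] by simp
  then have "v ((1 - q) * z y) \<le> 1"
    using v_q_number_le_1 by (rule v_mult_le_1)
  then show ?thesis
    using v_diff[of 1 "(1 - q) * z y"] unfolding q_power_eq by (simp add: v_1)
qed

text \<open>The difference is \<open>q - 1\<close> times an integral element. Hence
  \<open>v_geom_sum_p\<close> applies to the base \<open>q ^ p ^ N\<close> at every level.\<close>

lemma v_q_pow_minus_1: "v (q ^ n - 1) < r"
proof -
  have "q ^ n - 1 = geom_sum q n * (q - 1)"
    using one_diff_mult_geom_sum[of q n] by (simp add: algebra_simps)
  moreover have "v (geom_sum q n) \<le> 1"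
    unfolding geom_sum_def by (intro v_sum_le v_power_le_1) (simp_all add: v_q)
  ultimately show ?thesis
    using v_mult_le[of "geom_sum q n" "q - 1"] q by simp
qed

lemma v_geom_sum_le_1: "v (geom_sum (q ^ m) n) \<le> 1"
  unfolding geom_sum_def by (intro v_sum_le v_power_le_1) (simp_all add: v_q)

section \<open>Riemann sums of the moments and their convergence\<close>

abbreviation P :: "nat \<Rightarrow> 'a" where
  "P N \<equiv> geom_sum q (p ^ N)"

text \<open>The ratio of the normalizing factors at levels \<open>N + 1\<close> and
  \<open>N\<close>.\<close>

abbreviation Q :: "nat \<Rightarrow> 'a" where
  "Q N \<equiv> geom_sum (q ^ p ^ N) p"

lemma v_geom_sum_p_level: "v (Q N) = 1 / real p"
  using v_geom_sum_p[OF v_q_pow_minus_1[of "p ^ N"]] by simp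

lemma geom_sum_prime_power_Suc: "P (Suc N) = P N * Q N"
  using geom_sum_mult[of q "p ^ N" p] by (simp add: mult.commute)

lemma v_geom_sum_prime_power: "v (P N) = (1 / real p) ^ N"
proof (induction N)
  case 0
  then show ?case by (simp add: geom_sum_def v_1)
next
  case (Suc N)
  then show ?case
    unfolding geom_sum_prime_power_Suc v_mult v_geom_sum_p_level by simp
qed

lemma geom_sum_prime_power_nonzero: "P N \<noteq> 0"
proof
  assume "P N = 0"
  then show False
    using v_geom_sum_prime_power[of N] p_gt_1 by simp
qed

definition q_moment :: "nat \<Rightarrow> nat \<Rightarrow> 'a" where
  "q_moment N m = 1 / P N * (\<Sum>y<p ^ N. z y ^ m * q ^ y)"

lemma geom_sum_mult_q_moment: "P N * q_moment N m = (\<Sum>y<p ^ N. z y ^ m * q ^ y)"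
  using geom_sum_prime_power_nonzero by (simp add: q_moment_def)

text \<open>Write the points of level \<open>N + 1\<close> as \<open>p ^ N * k + y\<close> and
  expand to second order. The zeroth order reproduces level \<open>N\<close>; the first order
  carries one factor \<open>P N\<close> and the second order two. One \<open>P N\<close> is then
  cancelled.\<close>

lemma q_moment_step:
  obtains G R where "v G \<le> 1" and "v R \<le> 1"
    and "Q N * (q_moment (Suc N) m - q_moment N m) =
      of_nat m * G * (P N * q_moment N (m - 1) - (1 - q) * (P N * q_moment N m)) + P N * R"
proof -
  define g where "g k = geom_sum (q ^ p ^ N) k" for k
  define w where "w y = q_power v q (x + of_nat y)" for y
  \<comment> \<open>The increment of the q-number from \<open>y\<close> to
    \<open>p ^ N * k + y\<close>.\<close>
  define h where "h k y = w y * (P N * g k)" for k y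
  have le: "v (P N) \<le> 1" "v (g k) \<le> 1" "v (w y) \<le> 1" for k y
    using v_geom_sum_le_1[of 1] v_geom_sum_le_1 v_q_power_le_1 by (simp_all add: g_def w_def)
  have z_h: "z (p ^ N * k + y) = z y + h k y" for k y
    unfolding q_number_add h_def w_def g_def geom_sum_mult ..
  have "v (h k y) \<le> 1" for k y
    unfolding h_def by (intro v_mult_le_1 le)
  then have "\<exists>R. v R \<le> 1 \<and> (z y + h k y) ^ m =
      z y ^ m + of_nat m * z y ^ (m - 1) * h k y + h k y ^ 2 * R" for k y
    using v_q_number_le_1 by (intro power_add_expand)
  then have "\<exists>R. \<forall>k y. v (R k y) \<le> 1 \<and> (z y + h k y) ^ m =
      z y ^ m + of_nat m * z y ^ (m - 1) * h k y + h k y ^ 2 * R k y"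
    by (intro choice allI) blast
  then obtain R where R: "\<And>k y. v (R k y) \<le> 1" "\<And>k y. (z y + h k y) ^ m =
      z y ^ m + of_nat m * z y ^ (m - 1) * h k y + h k y ^ 2 * R k y"
    by blast
  define G where "G = (\<Sum>k<p. g k * (q ^ p ^ N) ^ k)"
  define R' where "R' = (\<Sum>k<p. \<Sum>y<p ^ N. (w y * g k) ^ 2 * R k y * (q ^ y * (q ^ p ^ N) ^ k))"
  have v_q_le: "v q \<le> 1"
    by (simp add: v_q)
  have "v G \<le> 1"
    unfolding G_def by (intro v_sum_le v_mult_le_1 v_power_le_1 le v_q_le) simp
  moreover have "v R' \<le> 1"
    unfolding R'_def by (intro v_sum_le v_mult_le_1 v_power_le_1 le v_q_le R) simp_all
  moreover have "Q N * (q_moment (Suc N) m - q_moment N m) =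
      of_nat m * G * (P N * q_moment N (m - 1) - (1 - q) * (P N * q_moment N m)) + P N * R'"
  proof -
    \<comment> \<open>Writing \<open>w y = 1 - (1 - q) * z y\<close> turns the first-order sum into
      moments. At \<open>m = 0\<close> the truncated \<open>m - 1\<close> does no harm, as the
      factor \<open>of_nat m\<close> vanishes.\<close>
    have zw: "(\<Sum>y<p ^ N. z y ^ (m - 1) * w y * q ^ y) = P N * q_moment N (m - 1) - (1 - q) * (P N * q_moment N m)"
      if "m > 0"
    proof -
      have "z y ^ (m - 1) * w y * q ^ y = z y ^ (m - 1) * q ^ y - (1 - q) * (z y ^ m * q ^ y)" for y
        using that unfolding w_def q_power_eq by (cases m) (simp_all add: algebra_simps)
      then show ?thesis
        unfolding geom_sum_mult_q_moment by (simp add: sum_subtractf sum_distrib_left)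
    qed
    have "P N * (Q N * q_moment (Suc N) m) = (\<Sum>y<p ^ N * p. z y ^ m * q ^ y)"
      using geom_sum_mult_q_moment[of "Suc N" m] unfolding geom_sum_prime_power_Suc
      by (simp add: mult.assoc mult.commute[of p])
    also have "\<dots> = (\<Sum>k<p. \<Sum>y<p ^ N. (z y + h k y) ^ m * (q ^ y * (q ^ p ^ N) ^ k))"
      unfolding sum_lessThan_mult z_h power_add power_mult by (simp only: mult.commute)
    also have "\<dots> = (\<Sum>k<p. \<Sum>y<p ^ N. (q ^ p ^ N) ^ k * (z y ^ m * q ^ y)) +
        (\<Sum>k<p. \<Sum>y<p ^ N. P N * (of_nat m * (g k * (q ^ p ^ N) ^ k * (z y ^ (m - 1) * w y * q ^ y)))) +
        (\<Sum>k<p. \<Sum>y<p ^ N. P N * (P N * ((w y * g k) ^ 2 * R k y * (q ^ y * (q ^ p ^ N) ^ k))))"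
      unfolding R(2) sum.distrib [symmetric]
      by (intro sum.cong refl) (simp add: h_def algebra_simps power2_eq_square)
    also have "(\<Sum>k<p. \<Sum>y<p ^ N. (q ^ p ^ N) ^ k * (z y ^ m * q ^ y)) = Q N * (P N * q_moment N m)"
      unfolding geom_sum_mult_q_moment geom_sum_def[of "q ^ p ^ N"] sum_product ..
    also have "(\<Sum>k<p. \<Sum>y<p ^ N. P N * (of_nat m * (g k * (q ^ p ^ N) ^ k * (z y ^ (m - 1) * w y * q ^ y)))) =
        P N * (of_nat m * (G * (\<Sum>y<p ^ N. z y ^ (m - 1) * w y * q ^ y)))"
      by (simp only: G_def sum_product) (simp only: sum_distrib_left)
    also have "(\<Sum>k<p. \<Sum>y<p ^ N. P N * (P N * ((w y * g k) ^ 2 * R k y * (q ^ y * (q ^ p ^ N) ^ k)))) =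
        P N * (P N * R')"
      unfolding R'_def sum_distrib_left ..
    finally have "P N * (Q N * (q_moment (Suc N) m - q_moment N m)) =
        P N * (of_nat m * (G * (\<Sum>y<p ^ N. z y ^ (m - 1) * w y * q ^ y)) + P N * R')"
      by (simp add: algebra_simps)
    then have "Q N * (q_moment (Suc N) m - q_moment N m) =
        of_nat m * (G * (\<Sum>y<p ^ N. z y ^ (m - 1) * w y * q ^ y)) + P N * R'"
      using geom_sum_prime_power_nonzero by (simp only: mult_cancel_left) simp
    then show ?thesis
      using zw by (cases "m = 0") (simp_all add: mult.assoc)
  qed
  ultimately show thesis
    by (rule that)
qed

text \<open>Dividing by \<open>Q N\<close> costs exactly a factor \<open>p\<close>. Applied twice:
  with \<open>C = 1\<close> for boundedness, then with \<open>C = p * (1 / p) ^ N\<close> for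
  convergence.\<close>

lemma v_q_moment_step_le:
  assumes PJ: "\<And>m. v (P N * q_moment N m) \<le> C" and P: "v (P N) \<le> C"
  shows "v (q_moment (Suc N) m - q_moment N m) \<le> real p * C"
proof -
  obtain G R where GR: "v G \<le> 1" "v R \<le> 1" and eq: "Q N * (q_moment (Suc N) m - q_moment N m) =
      of_nat m * G * (P N * q_moment N (m - 1) - (1 - q) * (P N * q_moment N m)) + P N * R"
    by (rule q_moment_step)
  have "v (1 - q) \<le> 1"
    using q padic_radius_less_1 v_minus_commute[of q] by simp
  then have "v ((1 - q) * (P N * q_moment N m)) \<le> C"
    using v_mult_le PJ order_trans by blast
  then have "v (P N * q_moment N (m - 1) - (1 - q) * (P N * q_moment N m)) \<le> C"
    using v_diff PJ[of "m - 1"] by (meson max.bounded_iff order_trans)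
  moreover have "v (of_nat m * G) \<le> 1"
    by (intro v_mult_le_1 v_of_nat_le_1 GR)
  ultimately have "v (of_nat m * G * (P N * q_moment N (m - 1) - (1 - q) * (P N * q_moment N m))) \<le> C"
    using v_mult_le order_trans by blast
  moreover have "v (P N * R) \<le> C"
    using v_mult_le[OF GR(2), of "P N"] P by (simp add: mult.commute)
  ultimately have "v (Q N * (q_moment (Suc N) m - q_moment N m)) \<le> C"
    unfolding eq using v_ultrametric by (meson max.bounded_iff order_trans)
  then show ?thesis
    using p_gt_1 unfolding v_mult v_geom_sum_p_level by (simp add: field_simps)
qed

text \<open>Without its normalizing factor the Riemann sum is a sum of integral terms, so each step
  has size at most \<open>p\<close>; ultrametric steps do not accumulate.\<close>

lemma v_q_moment_le: "v (q_moment N m) \<le> real p"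
proof (induction N)
  case 0
  have "v (q_moment 0 m) \<le> 1"
    using v_power_le_1[OF v_q_number_le_1[of 0]] by (simp add: q_moment_def geom_sum_def)
  then show ?case
    using p_gt_1 by linarith
next
  case (Suc N)
  have "v (P N * q_moment N m) \<le> 1" for m
    unfolding geom_sum_mult_q_moment
    by (intro v_sum_le v_mult_le_1 v_power_le_1 v_q_number_le_1) (simp_all add: v_q)
  moreover have "v (P N) \<le> 1"
    using v_geom_sum_le_1[of 1] by simp
  ultimately have "v (q_moment (Suc N) m - q_moment N m) \<le> real p * 1"
    by (rule v_q_moment_step_le)
  then show ?case
    using Suc.IH v_ultrametric[of "q_moment (Suc N) m - q_moment N m" "q_moment N m"] by simp
qed

text \<open>Bootstrapping: once the moments are bounded, \<open>P N * q_moment N m\<close> is of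
  order \<open>(1 / p) ^ N\<close>, and so the steps tend to 0.\<close>

lemma q_moment_tendsto: "val_tendsto v (\<lambda>N. q_moment N m) (carlitz_beta p v q m x)"
proof -
  have "v (q_moment (Suc N) m - q_moment N m) \<le> real p * (real p * (1 / real p) ^ N)" for N
  proof (rule v_q_moment_step_le)
    show "v (P N * q_moment N m) \<le> real p * (1 / real p) ^ N" for m
      using mult_right_mono[OF v_q_moment_le[of N m], of "(1 / real p) ^ N"]
      by (simp add: v_mult v_geom_sum_prime_power mult.commute)
    have "1 * (1 / real p) ^ N \<le> real p * (1 / real p) ^ N"
      using p_gt_1 by (intro mult_right_mono) auto
    then show "v (P N) \<le> real p * (1 / real p) ^ N"
      by (simp add: v_geom_sum_prime_power)
  qed
  moreover have "(\<lambda>N. real p * (real p * (1 / real p) ^ N)) \<longlonglongrightarrow> 0"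
    using p_gt_1 by (intro tendsto_mult_right_zero LIMSEQ_realpow_zero) auto
  ultimately have "val_tendsto v (\<lambda>N. q_moment (Suc N) m - q_moment N m) 0"
    by (intro val_tendsto_sandwich) auto
  then obtain l where l: "val_tendsto v (\<lambda>N. q_moment N m) l"
    using val_convergent[of "\<lambda>N. q_moment N m"] by (auto simp: val_tendsto_iff)
  have "carlitz_beta p v q m x = val_lim v (\<lambda>N. q_moment N m)"
    unfolding carlitz_beta_def q_integral_def q_moment_def q_number_of_nat q_power_of_nat ..
  then show ?thesis
    using val_lim_eq[OF l] l by simp
qed

text \<open>Expand the integrand by \<open>padic_exp_log_sums\<close>, form Riemann sums term by
  term, and let the level grow under the dominated interchange.\<close>

lemma degenerate_carlitz_egf_signed_stirling:
  assumes lam: "lam \<noteq> 0"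
  shows "degenerate_carlitz_egf p v q lam x
    (\<lambda>n. \<Sum>m\<le>n. signed_stirling n m * lam ^ (n - m) * carlitz_beta p v q m x)"
  unfolding degenerate_carlitz_egf_def
proof (intro allI impI, elim conjE)
  fix t
  assume lt: "v (lam * t) < r" and t: "v t < r"
  define R where "R = max (v t) (v (lam * t))"
  have R: "0 \<le> R" "R < r"
    using lt t v_nonneg[of t] by (auto simp: R_def)
  \<comment> \<open>The coefficient of \<open>a ^ m\<close> in the degree-\<open>n\<close> term in
    \<open>t\<close> of the degenerate exponential.\<close>
  define c where "c n m = t ^ n / fact n * (signed_stirling n m * lam ^ (n - m))" for n m
  have c_le: "v (c n m) \<le> R ^ n / v (fact n)" if "m \<le> n" for n m
  proof -
    have "t ^ n * lam ^ (n - m) = t ^ m * (lam * t) ^ (n - m)"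
      using that by (simp add: power_mult_distrib flip: power_add)
    then have "c n m = signed_stirling n m * (t ^ m * (lam * t) ^ (n - m)) / fact n"
      by (simp add: c_def)
    then have "v (c n m) \<le> v t ^ m * v (lam * t) ^ (n - m) / v (fact n)"
      using v_mult_le[OF v_signed_stirling_le_1[of n m], of "t ^ m * (lam * t) ^ (n - m)"] v_nonneg
      by (simp only: v_divide v_mult v_power) (rule divide_right_mono)
    also have "\<dots> \<le> R ^ m * R ^ (n - m) / v (fact n)"
      using v_nonneg R by (intro divide_right_mono mult_mono power_mono) (auto simp: R_def)
    also have "\<dots> = R ^ n / v (fact n)"
      using that by (simp flip: power_add)
    finally show ?thesis .
  qed
  have deg: "val_sums v (\<lambda>n. \<Sum>m\<le>n. c n m * a ^ m) (degenerate_exp v lam a t)"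
    if "v a \<le> 1" for a
  proof -
    \<comment> \<open>The product is \<open>a * t\<close>; this is where the bound on
      \<open>v t\<close> itself enters.\<close>
    have "v (a / lam * (lam * t)) < r"
      using v_mult_le[OF that, of t] t lam by simp
    from padic_exp_log_sums[OF lt this]
    have "val_sums v (\<lambda>n. (lam * t) ^ n / fact n * (\<Sum>m\<le>n. signed_stirling n m * (a / lam) ^ m))
        (degenerate_exp v lam a t)"
      by (simp add: degenerate_exp_def)
    moreover have "(lam * t) ^ n / fact n * (\<Sum>m\<le>n. signed_stirling n m * (a / lam) ^ m) =
        (\<Sum>m\<le>n. c n m * a ^ m)" for n
      unfolding sum_distrib_left
    proof (intro sum.cong refl)
      fix m
      assume "m \<in> {..n}"
      then have "lam ^ n = lam ^ (n - m) * lam ^ m"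
        by (simp flip: power_add)
      then show "(lam * t) ^ n / fact n * (signed_stirling n m * (a / lam) ^ m) = c n m * a ^ m"
        using lam by (simp add: c_def power_mult_distrib power_divide)
    qed
    ultimately show ?thesis by simp
  qed
  define I where "I N = 1 / P N * (\<Sum>y<p ^ N. degenerate_exp v lam (z y) t * q ^ y)" for N
  have I: "val_sums v (\<lambda>n. \<Sum>m\<le>n. c n m * q_moment N m) (I N)" for N
  proof -
    have "val_sums v (\<lambda>n. 1 / P N * (\<Sum>y<p ^ N. q ^ y * (\<Sum>m\<le>n. c n m * z y ^ m)))
        (1 / P N * (\<Sum>y<p ^ N. q ^ y * degenerate_exp v lam (z y) t))"
      by (intro val_sums_mult_left val_sums_sum deg v_q_number_le_1)
    moreover have "1 / P N * (\<Sum>y<p ^ N. q ^ y * (\<Sum>m\<le>n. c n m * z y ^ m)) = (\<Sum>m\<le>n. c n m * q_moment N m)" for n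
    proof -
      have "(\<Sum>y<p ^ N. q ^ y * (\<Sum>m\<le>n. c n m * z y ^ m)) =
          (\<Sum>m\<le>n. c n m * (\<Sum>y<p ^ N. z y ^ m * q ^ y))"
        unfolding sum_distrib_left by (subst sum.swap) (simp add: mult_ac)
      then show ?thesis
        by (simp add: q_moment_def sum_distrib_left sum_divide_distrib)
    qed
    ultimately show ?thesis
      by (simp add: I_def mult.commute)
  qed
  \<comment> \<open>The majorant is free of \<open>N\<close> because the moments are bounded
    uniformly in level and order.\<close>
  have le: "v (\<Sum>m\<le>n. c n m * q_moment N m) \<le> R ^ n / v (fact n) * real p" for N n
  proof (rule v_sum_le)
    fix m
    assume "m \<in> {..n}"
    then show "v (c n m * q_moment N m) \<le> R ^ n / v (fact n) * real p"
      unfolding v_mult using c_le v_q_moment_le v_nonneg R by (intro mult_mono) auto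
  qed (use R v_nonneg in simp)
  have lim: "val_tendsto v (\<lambda>N. \<Sum>m\<le>n. c n m * q_moment N m) (\<Sum>m\<le>n. c n m * carlitz_beta p v q m x)" for n
    by (intro val_tendsto_sum val_tendsto_mult_left q_moment_tendsto)
  obtain S where S: "val_sums v (\<lambda>n. \<Sum>m\<le>n. c n m * carlitz_beta p v q m x) S" "val_tendsto v I S"
    using val_tendsto_sums_swap[OF I le _ lim]
      tendsto_mult_left_zero[OF power_div_v_fact_tendsto_0[OF R]] by blast
  have "q_integral p v q (\<lambda>y. degenerate_exp v lam (q_number v q (x + y)) t) = S"
    using val_lim_eq[OF S(2)] unfolding q_integral_def I_def q_number_of_nat q_power_of_nat .
  moreover have "(\<Sum>m\<le>n. c n m * carlitz_beta p v q m x) =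
      (\<Sum>m\<le>n. signed_stirling n m * lam ^ (n - m) * carlitz_beta p v q m x) * t ^ n / fact n" for n
    unfolding sum_distrib_right sum_divide_distrib by (simp add: c_def mult_ac)
  ultimately show "val_sums v
      (\<lambda>n. (\<Sum>m\<le>n. signed_stirling n m * lam ^ (n - m) * carlitz_beta p v q m x) * t ^ n / fact n)
      (q_integral p v q (\<lambda>y. degenerate_exp v lam (q_number v q (x + y)) t))"
    using S(1) by simp
qed

end

section \<open>Uniqueness of the coefficients of the generating function\<close>

context padic_complex
begin

text \<open>Evaluate at \<open>s * t\<close> with \<open>t\<close> fixed and
  \<open>s = p ^ i\<close>. With the lower coefficients already zero, the \<open>k\<close>-th term
  has order \<open>s ^ k\<close> but equals, up to sign, a tail of order \<open>s ^ (k + 1)\<close>;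
  let \<open>i\<close> grow.\<close>

lemma power_series_eq_0:
  assumes "0 < \<rho>" and sums: "\<And>t. v t < \<rho> \<Longrightarrow> val_sums v (\<lambda>n. d n * t ^ n) 0"
  shows "d n = 0"
proof (induction n rule: less_induct)
  case (less k)
  define \<pi> where "\<pi> i = (of_nat p :: 'a) ^ i" for i
  have v_\<pi>: "v (\<pi> i) = (1 / real p) ^ i" for i
    by (simp add: \<pi>_def v_power v_p)
  have lim: "(\<lambda>i. (1 / real p) ^ i) \<longlonglongrightarrow> 0"
    using p_gt_1 by (intro LIMSEQ_realpow_zero) auto
  obtain j where j: "v (\<pi> j) < \<rho>"
    unfolding v_\<pi> using real_arch_pow_inv[OF \<open>0 < \<rho>\<close>, of "1 / real p"] p_gt_1 by auto
  define t where "t = \<pi> j"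
  have "t \<noteq> 0"
    using p_gt_1 by (simp add: t_def \<pi>_def)
  obtain M where M: "0 < M" "\<And>n. v (d n * t ^ n) \<le> M"
    using tendsto_0_bounded[OF val_sums_terms_tendsto_0[OF sums[OF j]]] unfolding t_def by blast
  have le: "v (d k * t ^ k) \<le> M * (1 / real p) ^ i" for i
  proof -
    define s where "s = \<pi> i"
    have s: "v s \<le> 1" "0 < v s"
      using p_gt_1 by (simp_all add: s_def v_\<pi> power_le_one)
    have "v (s * t) < \<rho>"
      using v_mult_le[OF s(1), of t] j by (simp add: t_def)
    note sums_st = sums[OF this]
    have nonneg: "0 \<le> M * v s ^ Suc k"
      by (intro mult_nonneg_nonneg zero_le_power) (use M(1) s(2) in linarith)+
    have "v (d n * (s * t) ^ n) \<le> M * v s ^ Suc k" if "Suc k \<le> n" for n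
    proof -
      have "v (d n * (s * t) ^ n) = v (d n * t ^ n) * v s ^ n"
        by (simp add: v_mult v_power power_mult_distrib mult_ac)
      also have "\<dots> \<le> M * v s ^ Suc k"
        using M s that v_nonneg by (intro mult_mono power_decreasing) auto
      finally show ?thesis .
    qed
    then have tail: "v (0 - (\<Sum>n<Suc k. d n * (s * t) ^ n)) \<le> M * v s ^ Suc k"
      by (rule val_sums_tail_le[OF sums_st _ nonneg])
    have "(\<Sum>n<Suc k. d n * (s * t) ^ n) = d k * t ^ k * s ^ k"
      using less.IH by (simp add: power_mult_distrib mult_ac)
    from tail[unfolded this] have "v (d k * t ^ k) * v s ^ k \<le> (M * v s) * v s ^ k"
      by (simp add: v_minus v_mult v_power mult_ac)
    then show ?thesis
      using s by (simp add: s_def v_\<pi>)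
  qed
  have "v (d k * t ^ k) \<le> 0"
    using tendsto_mult_right_zero[OF lim, of M] le by (intro LIMSEQ_le_const) auto
  then have "d k * t ^ k = 0"
    using v_nonneg[of "d k * t ^ k"] v_eq_0_iff by simp
  then show ?case
    using \<open>t \<noteq> 0\<close> by simp
qed

lemma degenerate_carlitz_egf_unique:
  assumes b: "degenerate_carlitz_egf p v q lam x b" and b': "degenerate_carlitz_egf p v q lam x b'"
  shows "b = b'"
proof
  fix n
  \<comment> \<open>Below this radius both \<open>t\<close> and \<open>lam * t\<close> satisfy the
    convergence bounds.\<close>
  define \<rho> where "\<rho> = r / max 1 (v lam)"
  have "0 < \<rho>"
    using padic_radius_pos by (simp add: \<rho>_def)
  moreover have "val_sums v (\<lambda>n. (b n - b' n) / fact n * t ^ n) 0" if "v t < \<rho>" for t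
  proof -
    have "v t * max 1 (v lam) < r"
      using that by (simp add: \<rho>_def pos_less_divide_eq)
    moreover have "v t * 1 \<le> v t * max 1 (v lam)" "v t * v lam \<le> v t * max 1 (v lam)"
      using v_nonneg by (intro mult_left_mono; simp)+
    ultimately have t: "v (lam * t) < r \<and> v t < r"
      by (simp add: v_mult mult.commute)
    obtain I where "val_sums v (\<lambda>n. b n * t ^ n / fact n) I" "val_sums v (\<lambda>n. b' n * t ^ n / fact n) I"
      using b b' t unfolding degenerate_carlitz_egf_def by blast
    then have "val_sums v (\<lambda>n. b n * t ^ n / fact n + - 1 * (b' n * t ^ n / fact n)) (I + - 1 * I)"
      by (intro val_sums_add val_sums_mult_left)
    moreover have "b n * t ^ n / fact n + - 1 * (b' n * t ^ n / fact n) =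
        (b n - b' n) / fact n * t ^ n" for n
      by (simp add: diff_divide_distrib left_diff_distrib)
    ultimately show ?thesis
      by simp
  qed
  ultimately have "(b n - b' n) / fact n = 0"
    by (rule power_series_eq_0)
  then show "b n = b' n"
    by simp
qed

end

section \<open>Stirling inversion\<close>

theorem theorem4:
  fixes p :: nat and v :: "'a::field_char_0 \<Rightarrow> real"
    and q lam x :: 'a and n :: nat
  assumes "padic_complex p v"
    and "v (q - 1) < real p powr (- 1 / (real p - 1))"
    and "lam \<noteq> 0"
    and "x \<in> padic_Zp v"
  shows "carlitz_beta p v q n x =
    (\<Sum>m=0..n. degenerate_carlitz_beta p v q lam m x * lam ^ (n - m) * of_nat (Stirling n m))"
proof -
  interpret padic_complex p v by fact
  interpret carlitz_setting p v q x
    by unfold_locales (use assms in \<open>auto simp: padic_radius_def padic_Zp_def\<close>)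
  let ?\<beta> = "\<lambda>k. carlitz_beta p v q k x"
  have b: "degenerate_carlitz_beta p v q lam m x =
      (\<Sum>k\<le>n. signed_stirling m k * lam ^ (m - k) * ?\<beta> k)" if "m \<le> n" for m
  proof -
    have "degenerate_carlitz_beta p v q lam m x = (\<Sum>k\<le>m. signed_stirling m k * lam ^ (m - k) * ?\<beta> k)"
      unfolding degenerate_carlitz_beta_def
      using the_equality[of "degenerate_carlitz_egf p v q lam x", OF
          degenerate_carlitz_egf_signed_stirling[OF assms(3)] degenerate_carlitz_egf_unique[OF _
            degenerate_carlitz_egf_signed_stirling[OF assms(3)]]]
      by simp
    \<comment> \<open>Padding with the zeros \<open>signed_stirling m k\<close> for
      \<open>k > m\<close> gives the inner sum a range independent of \<open>m\<close>, so the sums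
      can be swapped.\<close>
    also have "\<dots> = (\<Sum>k\<le>n. signed_stirling m k * lam ^ (m - k) * ?\<beta> k)"
      using that by (intro sum.mono_neutral_left) auto
    finally show ?thesis .
  qed
  have "(\<Sum>m=0..n. degenerate_carlitz_beta p v q lam m x * lam ^ (n - m) * of_nat (Stirling n m)) =
      (\<Sum>m\<le>n. \<Sum>k\<le>n. lam ^ (n - k) * ?\<beta> k * (of_nat (Stirling n m) * signed_stirling m k))"
    unfolding atLeast0AtMost
  proof (intro sum.cong refl)
    fix m
    assume "m \<in> {..n}"
    then have m: "m \<le> n" by simp
    have "signed_stirling m k * lam ^ (m - k) * ?\<beta> k * lam ^ (n - m) * of_nat (Stirling n m) =
        lam ^ (n - k) * ?\<beta> k * (of_nat (Stirling n m) * signed_stirling m k)" for k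
    \<comment> \<open>For \<open>m < k\<close> both sides vanish; otherwise no subtraction is
      truncated and \<open>(m - k) + (n - m) = n - k\<close>.\<close>
    proof (cases "m < k")
      case False
      then have "lam ^ (n - k) = lam ^ (m - k) * lam ^ (n - m)"
        using m by (simp flip: power_add)
      then show ?thesis by simp
    qed simp
    then show "degenerate_carlitz_beta p v q lam m x * lam ^ (n - m) * of_nat (Stirling n m) =
        (\<Sum>k\<le>n. lam ^ (n - k) * ?\<beta> k * (of_nat (Stirling n m) * signed_stirling m k))"
      unfolding b[OF m] sum_distrib_right by (intro sum.cong refl)
  qed
  also have "\<dots> = (\<Sum>k\<le>n. lam ^ (n - k) * ?\<beta> k * (\<Sum>m\<le>n. of_nat (Stirling n m) * signed_stirling m k))"
    unfolding sum_distrib_left by (rule sum.swap)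
  also have "\<dots> = ?\<beta> n"
    unfolding sum_Stirling_signed_stirling by (simp add: if_distrib sum.delta cong: if_cong)
  finally show ?thesis ..
qed

end
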